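(* Let $a,b\in\mathbb{R}$ with $a\neq 0$, $b\neq 0$, and let $(L,H,G)$ be the 4-dimensional almost hypercomplex manifold with Hermitian-Norden metrics constructed (as in the context) on a simply connected 4-dimensional real Lie group $L$ whose Lie algebra is $g_{4,5}$ with parameters $a,b$. Then: \begin{enumerate} \item $(L,H,G)$ has vanishing Nijenhuis tensors ($N_\alpha=0$ for all $\alpha\in\{1,2,3\}$) if and only if $a=b=1$; \item $(L,H,G)$ is non-flat, i.e. $R\neq0$ (for every $a,b$); \item $(L,H,G)$ has positive scalar curvature $\tau>0$ (for every $a,b$); \item $(L,H,G)$ is $*$-scalar flat, i.e. $\tau_\alpha^*=0$ for all $\alpha\in\{1,2,3\}$ (for every $a,b$); \item $(L,H,G)$ is $**$-scalar flat w.r.t. $J_1$, i.e. $\tau_1^{**}=0$, if and only if $a=-b^2$; \item $(L,H,G)$ is $**$-scalar flat w.r.t. $J_2$, i.e. $\tau_2^{**}=0$, if and only if $b=-a^2$; \item $(L,H,G)$ is $**$-scalar flat w.r.t. $J_3$, i.e. $\tau_3^{**}=0$, if and only if $ab=-1$; \item all basic holomorphic sectional curvatures w.r.t. $J_1$ are positive if and only if $a>0$; \item all basic holomorphic sectional curvatures w.r.t. $J_2$ are positive if and only if $b>0$; \item all basic holomorphic sectional curvatures w.r.t. $J_3$ are positive if and only if $ab>0$; \item all basic totally real sectional curvatures (w.r.t. $J_1$, $J_2$, $J_3$) are positive if and only if $a>0$ and $b>0$. \end{enumerate}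
   Context: Lie algebra. $g_{4,5}$ is the real Lie algebra with basis $\{e_1,e_2,e_3,e_4\}$ whose only non-zero brackets (up to antisymmetry) are $[e_1,e_4]=e_1$, $[e_2,e_4]=a e_2$, $[e_3,e_4]=b e_3$, with $a\neq0$, $b\neq0$. The $e_i$ are regarded as left-invariant vector fields on $L$. Structure. Left-invariant almost complex structures $J_1,J_2,J_3$ are defined by $J_1e_1=e_2$, $J_1e_2=-e_1$, $J_1e_3=-e_4$, $J_1e_4=e_3$; $J_2e_1=e_3$, $J_2e_2=e_4$, $J_2e_3=-e_1$, $J_2e_4=-e_2$; $J_3e_1=-e_4$, $J_3e_2=e_3$, $J_3e_3=-e_2$, $J_3e_4=e_1$; and $H=(J_1,J_2,J_3)$. The left-invariant neutral metric $g$ is $g(x,y)=x^1y^1+x^2y^2-x^3y^3-x^4y^4$ for $x=\sum_i x^ie_i$, $y=\sum_i y^ie_i$. Set $g_\alpha(x,y)=g(J_\alpha x,y)$ and $G=(g,g_1,g_2,g_3)$; $\nabla$ is the Levi-Civita connection of $g$. Nijenhuis tensor of $J_\alpha$: $N_\alpha(x,y)=(\nabla_xJ_\alpha)J_\alpha y-(\nabla_yJ_\alpha)J_\alpha x+(\nabla_{J_\alpha x}J_\alpha)y-(\nabla_{J_\alpha y}J_\alpha)x$. Curvature. $R(x,y)z=\nabla_x\nabla_yz-\nabla_y\nabla_xz-\nabla_{[x,y]}z$, $R(x,y,z,w)=g(R(x,y)z,w)$; $\rho(y,z)=g^{ij}R(e_i,y,z,e_j)$, $\rho_\alpha^*(y,z)=g^{ij}R(e_i,y,z,J_\alpha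 e_j)$; $\tau=g^{ij}\rho(e_i,e_j)$, $\tau_\alpha^*=g^{ij}\rho_\alpha^*(e_i,e_j)$, $\tau_\alpha^{**}=g^{ij}\rho_\alpha^*(e_i,J_\alpha e_j)$. Sectional curvatures. For a non-degenerate 2-plane $\mu$ with basis $\{x,y\}$, $k(\mu)=\dfrac{R(x,y,y,x)}{g(x,x)g(y,y)-g(x,y)^2}$. The basic 2-planes are those spanned by $\{e_i,e_j\}$, $i\neq j$; their sectional curvatures $k_{ij}$ are called basic. A 2-plane $\mu$ is holomorphic w.r.t. $J_\alpha$ if $\mu=J_\alpha\mu$, and totally real w.r.t. $J_\alpha$ if $\mu\perp J_\alpha\mu\neq\mu$ with respect to $g$. A basic sectional curvature is called holomorphic (resp. totally real) w.r.t. $J_\alpha$ if the corresponding basic 2-plane is. *)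

theory Defs
  imports "HOL-Analysis.Analysis" "HOL-Library.Function_Algebras" "HOL-Algebra.Group"
begin

section \<open>Smooth manifolds and Lie groups\<close>

text \<open>Maps of class C^k and smooth maps on an open subset of a Euclidean space.\<close>

fun Ck_on :: "nat \<Rightarrow> 'a::euclidean_space set \<Rightarrow> ('a \<Rightarrow> 'b::real_normed_vector) \<Rightarrow> bool" where
  "Ck_on 0 S f \<longleftrightarrow> continuous_on S f"
| "Ck_on (Suc k) S f \<longleftrightarrow> f differentiable_on S \<and>
     (\<forall>v. Ck_on k S (\<lambda>x. frechet_derivative f (at x) v))"

definition smooth_on :: "'a::euclidean_space set \<Rightarrow> ('a \<Rightarrow> 'b::real_normed_vector) \<Rightarrow> bool" where
  "smooth_on S f \<longleftrightarrow> (\<forall>k. Ck_on k S f)"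

text \<open>A chart is a pair of a domain and a coordinate map; the values of the coordinate map outside
  the domain are irrelevant. The whole type is the underlying space of the manifold.\<close>

type_synonym ('m, 'e) atlas = "('m set \<times> ('m \<Rightarrow> 'e)) set"

definition smooth_atlas :: "('m::topological_space, 'e::euclidean_space) atlas \<Rightarrow> bool" where
  "smooth_atlas A \<longleftrightarrow>
     (\<Union>(U, \<phi>)\<in>A. U) = UNIV \<and>
     (\<forall>(U, \<phi>)\<in>A. open U \<and> open (\<phi> ` U) \<and> homeomorphism U (\<phi> ` U) \<phi> (inv_into U \<phi>)) \<and>
     (\<forall>(U, \<phi>)\<in>A. \<forall>(V, \<psi>)\<in>A. smooth_on (\<phi> ` (U \<inter> V)) (\<psi> \<circ> inv_into U \<phi>))"

definition smooth_fun :: "('m, 'e::euclidean_space) atlas \<Rightarrow> ('m \<Rightarrow> real) \<Rightarrow> bool" where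
  "smooth_fun A f \<longleftrightarrow> (\<forall>(U, \<phi>)\<in>A. smooth_on (\<phi> ` U) (f \<circ> inv_into U \<phi>))"

definition smooth_map :: "('m::topological_space, 'e::euclidean_space) atlas \<Rightarrow>
    ('n::topological_space, 'd::euclidean_space) atlas \<Rightarrow> ('m \<Rightarrow> 'n) \<Rightarrow> bool" where
  "smooth_map A B F \<longleftrightarrow> continuous_on UNIV F \<and>
     (\<forall>(U, \<phi>)\<in>A. \<forall>(V, \<psi>)\<in>B. smooth_on (\<phi> ` (U \<inter> F -` V)) (\<psi> \<circ> F \<circ> inv_into U \<phi>))"

definition prod_atlas :: "('m, 'e) atlas \<Rightarrow> ('n, 'd) atlas \<Rightarrow> ('m \<times> 'n, 'e \<times> 'd) atlas" where
  "prod_atlas A B = {(U \<times> V, map_prod \<phi> \<psi>) | U \<phi> V \<psi>. (U, \<phi>) \<in> A \<and> (V, \<psi>) \<in> B}"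

definition lie_group ::
    "('m::{t2_space, second_countable_topology}) monoid \<Rightarrow> ('m, 'e::euclidean_space) atlas \<Rightarrow> bool" where
  "lie_group L A \<longleftrightarrow>
     smooth_atlas A \<and> group L \<and> carrier L = UNIV \<and>
     smooth_map (prod_atlas A A) A (\<lambda>(p, q). p \<otimes>\<^bsub>L\<^esub> q) \<and>
     smooth_map A A (\<lambda>p. inv\<^bsub>L\<^esub> p)"


section \<open>Vector fields and the Lie algebra of a Lie group\<close>

text \<open>A tangent vector is encoded by its directional derivative on functions, a vector field X by
  the operator mapping f to X f. Only smooth functions f matter; an operator is normalised to be 0 on
  all other arguments, so that equality of vector fields is equality of operators. In every chart, a
  smooth vector field is differentiation along a smooth field v of component vectors.\<close>

type_synonym 'm tangent = "('m \<Rightarrow> real) \<Rightarrow> real"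
type_synonym 'm vfield = "('m \<Rightarrow> real) \<Rightarrow> 'm \<Rightarrow> real"

definition vector_fields :: "('m, 'e::euclidean_space) atlas \<Rightarrow> 'm vfield set" where
  "vector_fields A = {X.
     (\<forall>f. \<not> smooth_fun A f \<longrightarrow> X f = 0) \<and>
     (\<forall>(U, \<phi>)\<in>A. \<exists>v. smooth_on (\<phi> ` U) v \<and>
        (\<forall>f p. smooth_fun A f \<longrightarrow> p \<in> U \<longrightarrow>
           X f p = frechet_derivative (f \<circ> inv_into U \<phi>) (at (\<phi> p)) (v (\<phi> p))))}"

definition fmult :: "('m \<Rightarrow> real) \<Rightarrow> 'm vfield \<Rightarrow> 'm vfield" (infixr "\<cdot>\<^sub>v" 72) where
  "h \<cdot>\<^sub>v X = (\<lambda>f p. h p * X f p)"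

definition bracket :: "'m vfield \<Rightarrow> 'm vfield \<Rightarrow> 'm vfield" where
  "bracket X Y = (\<lambda>f. X (Y f) - Y (X f))"

definition at_point :: "'m vfield \<Rightarrow> 'm \<Rightarrow> 'm tangent" where
  "at_point X p = (\<lambda>f. X f p)"

definition left_invariant :: "'m monoid \<Rightarrow> ('m, 'e::euclidean_space) atlas \<Rightarrow> 'm vfield \<Rightarrow> bool" where
  "left_invariant L A X \<longleftrightarrow>
     (\<forall>p f. smooth_fun A f \<longrightarrow> X (\<lambda>q. f (p \<otimes>\<^bsub>L\<^esub> q)) = (\<lambda>q. X f (p \<otimes>\<^bsub>L\<^esub> q)))"

definition lie_algebra :: "'m monoid \<Rightarrow> ('m, 'e::euclidean_space) atlas \<Rightarrow> 'm vfield set" where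
  "lie_algebra L A = {X \<in> vector_fields A. left_invariant L A X}"

definition lie_algebra_basis ::
    "'m monoid \<Rightarrow> ('m, 'e::euclidean_space) atlas \<Rightarrow> ('i::finite \<Rightarrow> 'm vfield) \<Rightarrow> bool" where
  "lie_algebra_basis L A e \<longleftrightarrow>
     (\<forall>i. e i \<in> lie_algebra L A) \<and>
     (\<forall>X\<in>lie_algebra L A. \<exists>!c :: real^'i. X = (\<Sum>i\<in>UNIV. (\<lambda>_. c $ i) \<cdot>\<^sub>v e i))"

text \<open>The Lie algebra of L is g_{4,5} with parameters a, b, and e is the defining basis. The index
  type 4 consists of 1, 2, 3 and 4 = 0.\<close>

definition g45_basis ::
    "'m monoid \<Rightarrow> ('m, real^4) atlas \<Rightarrow> real \<Rightarrow> real \<Rightarrow> (4 \<Rightarrow> 'm vfield) \<Rightarrow> bool" where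
  "g45_basis L A a b e \<longleftrightarrow>
     lie_algebra_basis L A e \<and>
     bracket (e 1) (e 4) = e 1 \<and>
     bracket (e 2) (e 4) = (\<lambda>_. a) \<cdot>\<^sub>v e 2 \<and>
     bracket (e 3) (e 4) = (\<lambda>_. b) \<cdot>\<^sub>v e 3 \<and>
     bracket (e 1) (e 2) = 0 \<and> bracket (e 1) (e 3) = 0 \<and> bracket (e 2) (e 3) = 0"


section \<open>The structure (H, G)\<close>

text \<open>All tensors below are given by constant components with respect to the left-invariant frame e.
  The coordinates (x^1,...,x^4) of a tangent vector at p are taken with respect to the basis
  e_1(p),...,e_4(p) of the tangent space at p.\<close>

definition frame_vec :: "(4 \<Rightarrow> 'm vfield) \<Rightarrow> 'm \<Rightarrow> real^4 \<Rightarrow> 'm tangent" where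
  "frame_vec e p x = (\<lambda>f. \<Sum>i\<in>UNIV. x $ i * e i f p)"

definition coords :: "(4 \<Rightarrow> 'm vfield) \<Rightarrow> 'm \<Rightarrow> 'm tangent \<Rightarrow> real^4" where
  "coords e p t = (THE x. t = frame_vec e p x)"

definition neutral_metric_at :: "(4 \<Rightarrow> 'm vfield) \<Rightarrow> 'm \<Rightarrow> 'm tangent \<Rightarrow> 'm tangent \<Rightarrow> real" where
  "neutral_metric_at e p s t = (let x = coords e p s; y = coords e p t in
     x $ 1 * y $ 1 + x $ 2 * y $ 2 - x $ 3 * y $ 3 - x $ 4 * y $ 4)"

definition neutral_metric :: "(4 \<Rightarrow> 'm vfield) \<Rightarrow> 'm vfield \<Rightarrow> 'm vfield \<Rightarrow> 'm \<Rightarrow> real" where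
  "neutral_metric e X Y = (\<lambda>p. neutral_metric_at e p (at_point X p) (at_point Y p))"

text \<open>\<open>J_basis $ \<alpha> $ i\<close> is the coordinate vector of J_\<alpha> e_i.\<close>

definition J_basis :: "real^4^4^3" where
  "J_basis = vector
     [vector [axis 2 1, - axis 1 1, - axis 4 1, axis 3 1],
      vector [axis 3 1, axis 4 1, - axis 1 1, - axis 2 1],
      vector [- axis 4 1, axis 3 1, - axis 2 1, axis 1 1]]"

definition J_at :: "(4 \<Rightarrow> 'm vfield) \<Rightarrow> 3 \<Rightarrow> 'm \<Rightarrow> 'm tangent \<Rightarrow> 'm tangent" where
  "J_at e \<alpha> p t = frame_vec e p (\<Sum>i\<in>UNIV. coords e p t $ i *\<^sub>R (J_basis $ \<alpha> $ i))"

definition J_field :: "(4 \<Rightarrow> 'm vfield) \<Rightarrow> 3 \<Rightarrow> 'm vfield \<Rightarrow> 'm vfield" where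
  "J_field e \<alpha> X = (\<lambda>f p. J_at e \<alpha> p (at_point X p) f)"

text \<open>Affine connections and the Levi-Civita connection of a metric g; only the values on
  smooth vector fields matter.\<close>

definition affine_connection ::
    "('m, 'e::euclidean_space) atlas \<Rightarrow> ('m vfield \<Rightarrow> 'm vfield \<Rightarrow> 'm vfield) \<Rightarrow> bool" where
  "affine_connection A D \<longleftrightarrow>
     (\<forall>X\<in>vector_fields A. \<forall>Y\<in>vector_fields A. D X Y \<in> vector_fields A) \<and>
     (\<forall>X\<in>vector_fields A. \<forall>Y\<in>vector_fields A. \<forall>Z\<in>vector_fields A.
        D (X + Y) Z = D X Z + D Y Z \<and> D X (Y + Z) = D X Y + D X Z) \<and>
     (\<forall>f X Y. smooth_fun A f \<longrightarrow> X \<in> vector_fields A \<longrightarrow> Y \<in> vector_fields A \<longrightarrow>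
        D (f \<cdot>\<^sub>v X) Y = f \<cdot>\<^sub>v D X Y \<and>
        D X (f \<cdot>\<^sub>v Y) = X f \<cdot>\<^sub>v Y + f \<cdot>\<^sub>v D X Y)"

definition levi_civita :: "('m, 'e::euclidean_space) atlas \<Rightarrow> ('m vfield \<Rightarrow> 'm vfield \<Rightarrow> 'm \<Rightarrow> real) \<Rightarrow>
    ('m vfield \<Rightarrow> 'm vfield \<Rightarrow> 'm vfield) \<Rightarrow> bool" where
  "levi_civita A g D \<longleftrightarrow>
     affine_connection A D \<and>
     (\<forall>X\<in>vector_fields A. \<forall>Y\<in>vector_fields A. D X Y - D Y X = bracket X Y) \<and>
     (\<forall>X\<in>vector_fields A. \<forall>Y\<in>vector_fields A. \<forall>Z\<in>vector_fields A.
        X (g Y Z) = g (D X Y) Z + g Y (D X Z))"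


section \<open>Nijenhuis tensors and curvatures\<close>

text \<open>Throughout, D is the Levi-Civita connection.\<close>

definition nabla_J :: "(4 \<Rightarrow> 'm vfield) \<Rightarrow> ('m vfield \<Rightarrow> 'm vfield \<Rightarrow> 'm vfield) \<Rightarrow> 3 \<Rightarrow>
    'm vfield \<Rightarrow> 'm vfield \<Rightarrow> 'm vfield" where
  "nabla_J e D \<alpha> X Y = D X (J_field e \<alpha> Y) - J_field e \<alpha> (D X Y)"

definition nijenhuis :: "(4 \<Rightarrow> 'm vfield) \<Rightarrow> ('m vfield \<Rightarrow> 'm vfield \<Rightarrow> 'm vfield) \<Rightarrow> 3 \<Rightarrow>
    'm vfield \<Rightarrow> 'm vfield \<Rightarrow> 'm vfield" where
  "nijenhuis e D \<alpha> X Y =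
     nabla_J e D \<alpha> X (J_field e \<alpha> Y) - nabla_J e D \<alpha> Y (J_field e \<alpha> X)
     + nabla_J e D \<alpha> (J_field e \<alpha> X) Y - nabla_J e D \<alpha> (J_field e \<alpha> Y) X"

definition curv :: "('m vfield \<Rightarrow> 'm vfield \<Rightarrow> 'm vfield) \<Rightarrow>
    'm vfield \<Rightarrow> 'm vfield \<Rightarrow> 'm vfield \<Rightarrow> 'm vfield" where
  "curv D X Y Z = D X (D Y Z) - D Y (D X Z) - D (bracket X Y) Z"

definition curv4 :: "(4 \<Rightarrow> 'm vfield) \<Rightarrow> ('m vfield \<Rightarrow> 'm vfield \<Rightarrow> 'm vfield) \<Rightarrow>
    'm vfield \<Rightarrow> 'm vfield \<Rightarrow> 'm vfield \<Rightarrow> 'm vfield \<Rightarrow> 'm \<Rightarrow> real" where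
  "curv4 e D X Y Z W = neutral_metric e (curv D X Y Z) W"

definition metric_inv :: "(4 \<Rightarrow> 'm vfield) \<Rightarrow> 4 \<Rightarrow> 4 \<Rightarrow> 'm \<Rightarrow> real" where
  "metric_inv e i j p = matrix_inv (\<chi> k l. neutral_metric e (e k) (e l) p) $ i $ j"

definition ricci :: "(4 \<Rightarrow> 'm vfield) \<Rightarrow> ('m vfield \<Rightarrow> 'm vfield \<Rightarrow> 'm vfield) \<Rightarrow>
    'm vfield \<Rightarrow> 'm vfield \<Rightarrow> 'm \<Rightarrow> real" where
  "ricci e D Y Z p = (\<Sum>i\<in>UNIV. \<Sum>j\<in>UNIV. metric_inv e i j p * curv4 e D (e i) Y Z (e j) p)"

definition ricci_star :: "(4 \<Rightarrow> 'm vfield) \<Rightarrow> ('m vfield \<Rightarrow> 'm vfield \<Rightarrow> 'm vfield) \<Rightarrow> 3 \<Rightarrow>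
    'm vfield \<Rightarrow> 'm vfield \<Rightarrow> 'm \<Rightarrow> real" where
  "ricci_star e D \<alpha> Y Z p =
     (\<Sum>i\<in>UNIV. \<Sum>j\<in>UNIV. metric_inv e i j p * curv4 e D (e i) Y Z (J_field e \<alpha> (e j)) p)"

definition scal :: "(4 \<Rightarrow> 'm vfield) \<Rightarrow> ('m vfield \<Rightarrow> 'm vfield \<Rightarrow> 'm vfield) \<Rightarrow> 'm \<Rightarrow> real" where
  "scal e D p = (\<Sum>i\<in>UNIV. \<Sum>j\<in>UNIV. metric_inv e i j p * ricci e D (e i) (e j) p)"

definition scal_star :: "(4 \<Rightarrow> 'm vfield) \<Rightarrow> ('m vfield \<Rightarrow> 'm vfield \<Rightarrow> 'm vfield) \<Rightarrow> 3 \<Rightarrow>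
    'm \<Rightarrow> real" where
  "scal_star e D \<alpha> p = (\<Sum>i\<in>UNIV. \<Sum>j\<in>UNIV. metric_inv e i j p * ricci_star e D \<alpha> (e i) (e j) p)"

definition scal_star_star :: "(4 \<Rightarrow> 'm vfield) \<Rightarrow> ('m vfield \<Rightarrow> 'm vfield \<Rightarrow> 'm vfield) \<Rightarrow> 3 \<Rightarrow>
    'm \<Rightarrow> real" where
  "scal_star_star e D \<alpha> p =
     (\<Sum>i\<in>UNIV. \<Sum>j\<in>UNIV. metric_inv e i j p * ricci_star e D \<alpha> (e i) (J_field e \<alpha> (e j)) p)"

text \<open>The sectional curvature at p of the tangent plane spanned by X(p) and Y(p).\<close>

definition sect_curv :: "(4 \<Rightarrow> 'm vfield) \<Rightarrow> ('m vfield \<Rightarrow> 'm vfield \<Rightarrow> 'm vfield) \<Rightarrow>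
    'm vfield \<Rightarrow> 'm vfield \<Rightarrow> 'm \<Rightarrow> real" where
  "sect_curv e D X Y p =
     curv4 e D X Y Y X p / (neutral_metric e X X p * neutral_metric e Y Y p - (neutral_metric e X Y p)\<^sup>2)"

definition basic_plane :: "(4 \<Rightarrow> 'm vfield) \<Rightarrow> 'm \<Rightarrow> 4 \<Rightarrow> 4 \<Rightarrow> 'm tangent set" where
  "basic_plane e p i j = {\<lambda>f. c * e i f p + d * e j f p | c d :: real. True}"

definition holomorphic_plane :: "(4 \<Rightarrow> 'm vfield) \<Rightarrow> 3 \<Rightarrow> 'm \<Rightarrow> 'm tangent set \<Rightarrow> bool" where
  "holomorphic_plane e \<alpha> p \<mu> \<longleftrightarrow> \<mu> = J_at e \<alpha> p ` \<mu>"

definition totally_real_plane :: "(4 \<Rightarrow> 'm vfield) \<Rightarrow> 3 \<Rightarrow> 'm \<Rightarrow> 'm tangent set \<Rightarrow> bool" where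
  "totally_real_plane e \<alpha> p \<mu> \<longleftrightarrow>
     (\<forall>s\<in>\<mu>. \<forall>t\<in>J_at e \<alpha> p ` \<mu>. neutral_metric_at e p s t = 0) \<and> J_at e \<alpha> p ` \<mu> \<noteq> \<mu>"

definition holomorphic_curvatures_positive ::
    "(4 \<Rightarrow> 'm vfield) \<Rightarrow> ('m vfield \<Rightarrow> 'm vfield \<Rightarrow> 'm vfield) \<Rightarrow> 3 \<Rightarrow> bool" where
  "holomorphic_curvatures_positive e D \<alpha> \<longleftrightarrow>
     (\<forall>p i j. i \<noteq> j \<longrightarrow> holomorphic_plane e \<alpha> p (basic_plane e p i j) \<longrightarrow>
        sect_curv e D (e i) (e j) p > 0)"

definition totally_real_curvatures_positive ::
    "(4 \<Rightarrow> 'm vfield) \<Rightarrow> ('m vfield \<Rightarrow> 'm vfield \<Rightarrow> 'm vfield) \<Rightarrow> 3 \<Rightarrow> bool" where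
  "totally_real_curvatures_positive e D \<alpha> \<longleftrightarrow>
     (\<forall>p i j. i \<noteq> j \<longrightarrow> totally_real_plane e \<alpha> p (basic_plane e p i j) \<longrightarrow>
        sect_curv e D (e i) (e j) p > 0)"

end

theory Submission
  imports Defs
begin

text \<open>
  All objects are left-invariant, so everything becomes linear algebra on \<open>\<real>\<^sup>4\<close> once two facts are known:
  the \<open>e\<^sub>i\<close> form a basis of every tangent space with smooth coordinates, and the Levi-Civita connection has
  constant coefficients in this frame.

  The first fact is \<open>lie_algebra_basis_imp_smooth_frame\<close> (a relation between the \<open>e\<^sub>i\<close> at one point
  spreads to the whole group by left translation) together with \<open>vector_field_components\<close> (Cramer's rule
  in a chart makes the coordinates of a smooth vector field smooth). The second is \<open>D_frame\<close>: on the frame,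
  a metric connection is determined by its torsion, and a connection with the right torsion can be written
  down. By \<open>D_frame_field\<close> it is then known on all vector fields.

  Write \<open>[e\<^sub>i, e\<^sub>4] = \<lambda>\<^sub>i e\<^sub>i\<close> with \<open>\<lambda> = (1, a, b)\<close>. The curvature satisfies \<open>R(e\<^sub>i, e\<^sub>j) e\<^sub>j = \<plusminus> k\<^sub>i\<^sub>j e\<^sub>i\<close> with \<open>k\<^sub>i\<^sub>j = \<lambda>\<^sub>i \<lambda>\<^sub>j\<close> and
  \<open>k\<^sub>i\<^sub>4 = \<lambda>\<^sub>i\<^sup>2\<close> for \<open>i, j < 4\<close>. The scalar curvature is twice the sum of all \<open>k\<^sub>i\<^sub>j\<close>, which is
  \<open>(1 + a + b)\<^sup>2 + 1 + a\<^sup>2 + b\<^sup>2\<close>. Each \<open>J\<^sub>\<alpha>\<close> permutes the lines \<open>\<real> e\<^sub>i\<close> in pairs, \<open>12|34\<close>, \<open>13|24\<close> and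
  \<open>14|23\<close>: the pairs are the holomorphic basic planes, and all other basic planes are totally real. So the
  holomorphic curvatures are \<open>a, b\<^sup>2\<close> for \<open>J\<^sub>1\<close>, \<open>b, a\<^sup>2\<close> for \<open>J\<^sub>2\<close> and \<open>1, a b\<close> for \<open>J\<^sub>3\<close>, and the
  \<open>**\<close>-scalar curvature with respect to \<open>J\<^sub>\<alpha>\<close> is twice their sum. The totally real curvatures with
  respect to at least one \<open>J\<^sub>\<alpha>\<close> are all six. Finally, the Nijenhuis tensors depend pointwise on their
  arguments, and their components give \<open>nijenhuis_lin_vanishes_iff\<close>.
\<close>


section \<open>Calculus of smooth maps\<close>

text \<open>On an open set any derivative is the Frechet derivative, so \<open>C\<^sup>k\<^sup>+\<^sup>1\<close> may be tested on whatever
  formula for the derivative is at hand. All closure properties below rest on this.\<close>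

lemma Ck_on_Suc_iff:
  assumes "open S"
  shows "Ck_on (Suc k) S f \<longleftrightarrow>
    (\<exists>f'. (\<forall>x\<in>S. (f has_derivative f' x) (at x)) \<and> (\<forall>v. Ck_on k S (\<lambda>x. f' x v)))"
proof -
  have cong: "Ck_on k S f \<Longrightarrow> (\<And>x. x \<in> S \<Longrightarrow> f x = g x) \<Longrightarrow> Ck_on k S g"
    for k and f g :: "'a \<Rightarrow> 'c::real_normed_vector"
  proof (induction k arbitrary: f g)
    case 0
    then show ?case by (simp cong: continuous_on_cong)
  next
    case (Suc k)
    have f: "f differentiable at x" if "x \<in> S" for x
      using Suc.prems that assms by (simp add: differentiable_on_eq_differentiable_at)
    have fg: "(g has_derivative frechet_derivative f (at x)) (at x)" if "x \<in> S" for x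
      using has_derivative_transform_within_open[OF _ assms that Suc.prems(2)] f[OF that]
      by (simp add: frechet_derivative_works)
    have fr: "frechet_derivative f (at x) v = frechet_derivative g (at x) v" if "x \<in> S" for x v
      by (rule fun_cong[OF frechet_derivative_at[OF fg[OF that]]])
    have "Ck_on k S (\<lambda>x. frechet_derivative f (at x) v)" for v
      using Suc.prems(1) by simp
    from Suc.IH[OF this fr] have "Ck_on k S (\<lambda>x. frechet_derivative g (at x) v)" for v .
    moreover have "g differentiable_on S"
      using fg by (auto simp: differentiable_on_eq_differentiable_at[OF assms] differentiable_def)
    ultimately show ?case by simp
  qed
  show ?thesis
  proof
    assume "Ck_on (Suc k) S f"
    then show "\<exists>f'. (\<forall>x\<in>S. (f has_derivative f' x) (at x)) \<and> (\<forall>v. Ck_on k S (\<lambda>x. f' x v))"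
      by (intro exI[of _ "\<lambda>x. frechet_derivative f (at x)"])
        (auto simp: differentiable_on_eq_differentiable_at[OF assms] frechet_derivative_works)
  next
    assume "\<exists>f'. (\<forall>x\<in>S. (f has_derivative f' x) (at x)) \<and> (\<forall>v. Ck_on k S (\<lambda>x. f' x v))"
    then obtain f' where f': "\<And>x. x \<in> S \<Longrightarrow> (f has_derivative f' x) (at x)"
      and k: "\<And>v. Ck_on k S (\<lambda>x. f' x v)" by blast
    have "f' x = frechet_derivative f (at x)" if "x \<in> S" for x
      by (rule frechet_derivative_at[OF f'[OF that]])
    then have "Ck_on k S (\<lambda>x. frechet_derivative f (at x) v)" for v
      by (intro cong[OF k[of v]]) simp
    with f' show "Ck_on (Suc k) S f"
      by (auto simp: differentiable_on_eq_differentiable_at[OF assms] differentiable_def)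
  qed
qed

lemma Ck_on_SucI:
  assumes "open S" "\<And>x. x \<in> S \<Longrightarrow> (f has_derivative f' x) (at x)" "\<And>v. Ck_on k S (\<lambda>x. f' x v)"
  shows "Ck_on (Suc k) S f"
  unfolding Ck_on_Suc_iff[OF assms(1)] using assms(2,3) by (intro exI[of _ f']) simp

lemma Ck_on_SucE:
  assumes "open S" "Ck_on (Suc k) S f"
  obtains f' where "\<forall>x\<in>S. (f has_derivative f' x) (at x)" "\<forall>v. Ck_on k S (\<lambda>x. f' x v)"
  using assms(2) unfolding Ck_on_Suc_iff[OF assms(1)] by auto

lemma Ck_on_cong:
  assumes "open S" "\<And>x. x \<in> S \<Longrightarrow> f x = g x" "Ck_on k S f"
  shows "Ck_on k S g"
proof (cases k)
  case 0
  with assms show ?thesis by (simp cong: continuous_on_cong)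
next
  case (Suc l)
  obtain f' where "\<forall>x\<in>S. (f has_derivative f' x) (at x)" "\<forall>v. Ck_on l S (\<lambda>x. f' x v)"
    using Ck_on_SucE[OF assms(1) assms(3)[unfolded Suc]] .
  note f' = this[rule_format]
  have "(g has_derivative f' x) (at x)" if "x \<in> S" for x
    by (rule has_derivative_transform_within_open[OF f'(1)[OF that] assms(1) that assms(2)])
  then show ?thesis
    unfolding Suc by (rule Ck_on_SucI[OF assms(1) _ f'(2)])
qed

lemma Ck_on_Suc_imp:
  assumes "open S"
  shows "Ck_on (Suc k) S f \<Longrightarrow> Ck_on k S f"
proof (induction k arbitrary: f)
  case 0
  then show ?case by (simp add: differentiable_imp_continuous_on)
next
  case (Suc k)
  obtain f' where "\<forall>x\<in>S. (f has_derivative f' x) (at x)" "\<forall>v. Ck_on (Suc k) S (\<lambda>x. f' x v)"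
    using Ck_on_SucE[OF assms Suc.prems] .
  note f' = this[rule_format]
  show ?case by (rule Ck_on_SucI[OF assms f'(1) Suc.IH[OF f'(2)]])
qed

lemma Ck_on_const: "open S \<Longrightarrow> Ck_on k S (\<lambda>_. c)"
proof (induction k arbitrary: c)
  case (Suc k)
  show ?case by (rule Ck_on_SucI[OF Suc.prems has_derivative_const Suc.IH[OF Suc.prems]])
qed simp

lemma Ck_on_bounded_linear:
  assumes "open S" "bounded_linear h"
  shows "Ck_on k S f \<Longrightarrow> Ck_on k S (\<lambda>x. h (f x))"
proof (induction k arbitrary: f)
  case 0
  then show ?case using assms(2) by (simp add: bounded_linear.continuous_on)
next
  case (Suc k)
  obtain f' where "\<forall>x\<in>S. (f has_derivative f' x) (at x)" "\<forall>v. Ck_on k S (\<lambda>x. f' x v)"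
    using Ck_on_SucE[OF assms(1) Suc.prems] .
  note f' = this[rule_format]
  show ?case
    by (rule Ck_on_SucI[OF assms(1) bounded_linear.has_derivative[OF assms(2) f'(1)]
          Suc.IH[OF f'(2)]])
qed

lemma Ck_on_add:
  assumes "open S"
  shows "Ck_on k S f \<Longrightarrow> Ck_on k S g \<Longrightarrow> Ck_on k S (\<lambda>x. f x + g x)"
proof (induction k arbitrary: f g)
  case 0
  then show ?case by (simp add: continuous_on_add)
next
  case (Suc k)
  obtain f' where "\<forall>x\<in>S. (f has_derivative f' x) (at x)" "\<forall>v. Ck_on k S (\<lambda>x. f' x v)"
    using Ck_on_SucE[OF assms Suc.prems(1)] .
  note f' = this[rule_format]
  obtain g' where "\<forall>x\<in>S. (g has_derivative g' x) (at x)" "\<forall>v. Ck_on k S (\<lambda>x. g' x v)"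
    using Ck_on_SucE[OF assms Suc.prems(2)] .
  note g' = this[rule_format]
  show ?case
    by (rule Ck_on_SucI[OF assms has_derivative_add[OF f'(1) g'(1)] Suc.IH[OF f'(2) g'(2)]])
qed

lemma Ck_on_bilinear:
  assumes "open S" "bounded_bilinear h"
  shows "Ck_on k S f \<Longrightarrow> Ck_on k S g \<Longrightarrow> Ck_on k S (\<lambda>x. h (f x) (g x))"
proof (induction k arbitrary: f g)
  case 0
  then show ?case using assms(2) by (simp add: bounded_bilinear.continuous_on)
next
  case (Suc k)
  obtain f' where "\<forall>x\<in>S. (f has_derivative f' x) (at x)" "\<forall>v. Ck_on k S (\<lambda>x. f' x v)"
    using Ck_on_SucE[OF assms(1) Suc.prems(1)] .
  note f' = this[rule_format]
  obtain g' where "\<forall>x\<in>S. (g has_derivative g' x) (at x)" "\<forall>v. Ck_on k S (\<lambda>x. g' x v)"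
    using Ck_on_SucE[OF assms(1) Suc.prems(2)] .
  note g' = this[rule_format]
  note f = Ck_on_Suc_imp[OF assms(1) Suc.prems(1)] and g = Ck_on_Suc_imp[OF assms(1) Suc.prems(2)]
  show ?case
    by (rule Ck_on_SucI[OF assms(1) bounded_bilinear.FDERIV[OF assms(2) f'(1) g'(1)]
          Ck_on_add[OF assms(1) Suc.IH[OF f g'(2)] Suc.IH[OF f'(2) g]]])
qed

text \<open>The derivative of \<open>1/f\<close> is \<open>-(1/f) \<cdot> f' \<cdot> (1/f)\<close>, so the product rule turns smoothness of order
  \<open>k\<close> of \<open>1/f\<close> into smoothness of order \<open>k + 1\<close>.\<close>

lemma Ck_on_inverse:
  fixes f :: "'a::euclidean_space \<Rightarrow> real"
  assumes "open S" "\<And>x. x \<in> S \<Longrightarrow> f x \<noteq> 0"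
  shows "Ck_on k S f \<Longrightarrow> Ck_on k S (\<lambda>x. inverse (f x))"
proof (induction k)
  case 0
  then show ?case using assms(2) by (simp add: continuous_on_inverse)
next
  case (Suc k)
  obtain f' where "\<forall>x\<in>S. (f has_derivative f' x) (at x)" "\<forall>v. Ck_on k S (\<lambda>x. f' x v)"
    using Ck_on_SucE[OF assms(1) Suc.prems] .
  note f' = this[rule_format]
  have inv: "Ck_on k S (\<lambda>x. inverse (f x))"
    by (rule Suc.IH[OF Ck_on_Suc_imp[OF assms(1) Suc.prems]])
  have der: "Ck_on k S (\<lambda>x. - (inverse (f x) * f' x v * inverse (f x)))" for v
    by (rule Ck_on_bounded_linear[OF assms(1) bounded_linear_minus[OF bounded_linear_ident]])
      (rule Ck_on_bilinear[OF assms(1) bounded_bilinear_mult]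
        Ck_on_bilinear[OF assms(1) bounded_bilinear_mult] inv f'(2))+
  show ?case
    by (rule Ck_on_SucI[OF assms(1) Deriv.has_derivative_inverse[OF assms(2) f'(1)] der])
qed

lemma smooth_on_cong:
  "open S \<Longrightarrow> (\<And>x. x \<in> S \<Longrightarrow> f x = g x) \<Longrightarrow> smooth_on S f \<Longrightarrow> smooth_on S g"
  unfolding smooth_on_def using Ck_on_cong by blast

lemma smooth_on_differentiable:
  "open S \<Longrightarrow> smooth_on S f \<Longrightarrow> x \<in> S \<Longrightarrow> f differentiable at x"
  unfolding smooth_on_def
  by (metis Ck_on.simps(2) differentiable_on_eq_differentiable_at)

lemma smooth_on_const: "open S \<Longrightarrow> smooth_on S (\<lambda>_. c)"
  by (simp add: smooth_on_def Ck_on_const)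

lemma smooth_on_bounded_linear:
  "open S \<Longrightarrow> bounded_linear h \<Longrightarrow> smooth_on S f \<Longrightarrow> smooth_on S (\<lambda>x. h (f x))"
  by (simp add: smooth_on_def Ck_on_bounded_linear)

lemma smooth_on_add:
  "open S \<Longrightarrow> smooth_on S f \<Longrightarrow> smooth_on S g \<Longrightarrow> smooth_on S (\<lambda>x. f x + g x)"
  by (simp add: smooth_on_def Ck_on_add)

lemma smooth_on_scaleR:
  "open S \<Longrightarrow> smooth_on S f \<Longrightarrow> smooth_on S g \<Longrightarrow> smooth_on S (\<lambda>x. f x *\<^sub>R g x)"
  by (simp add: smooth_on_def Ck_on_bilinear bounded_bilinear_scaleR)

lemma smooth_on_mult:
  fixes f g :: "'a::euclidean_space \<Rightarrow> real"
  shows "open S \<Longrightarrow> smooth_on S f \<Longrightarrow> smooth_on S g \<Longrightarrow> smooth_on S (\<lambda>x. f x * g x)"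
  by (simp add: smooth_on_def Ck_on_bilinear bounded_bilinear_mult)

lemma smooth_on_divide:
  fixes f g :: "'a::euclidean_space \<Rightarrow> real"
  shows "open S \<Longrightarrow> smooth_on S f \<Longrightarrow> smooth_on S g \<Longrightarrow> (\<And>x. x \<in> S \<Longrightarrow> g x \<noteq> 0) \<Longrightarrow>
    smooth_on S (\<lambda>x. f x / g x)"
  unfolding divide_inverse
  by (intro smooth_on_mult) (auto simp: smooth_on_def Ck_on_inverse)

lemma smooth_on_sum:
  "open S \<Longrightarrow> (\<And>i. i \<in> I \<Longrightarrow> smooth_on S (f i)) \<Longrightarrow> smooth_on S (\<lambda>x. \<Sum>i\<in>I. f i x)"
  by (induction I rule: infinite_finite_induct) (auto intro: smooth_on_const smooth_on_add)

lemma smooth_on_prod: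
  fixes f :: "'i \<Rightarrow> 'a::euclidean_space \<Rightarrow> real"
  shows "open S \<Longrightarrow> (\<And>i. i \<in> I \<Longrightarrow> smooth_on S (f i)) \<Longrightarrow> smooth_on S (\<lambda>x. \<Prod>i\<in>I. f i x)"
  by (induction I rule: infinite_finite_induct) (auto intro: smooth_on_const smooth_on_mult)

lemma smooth_on_det:
  fixes M :: "'a::euclidean_space \<Rightarrow> real^'n^'n"
  assumes "open S" "\<And>i j. smooth_on S (\<lambda>x. M x $ i $ j)"
  shows "smooth_on S (\<lambda>x. det (M x))"
  unfolding det_def
  by (intro smooth_on_sum smooth_on_mult smooth_on_prod smooth_on_const assms)

lemma smooth_on_nth: "open S \<Longrightarrow> smooth_on S f \<Longrightarrow> smooth_on S (\<lambda>x. f x $ i)"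
  by (rule smooth_on_bounded_linear[OF _ bounded_linear_vec_nth])


section \<open>Vector fields as a module over the smooth functions\<close>

lemma chart_at:
  assumes "smooth_atlas A"
  obtains U \<phi> where "(U, \<phi>) \<in> A" "p \<in> U"
proof -
  have "p \<in> (\<Union>(U, \<phi>)\<in>A. U)"
    using assms by (simp add: smooth_atlas_def)
  then obtain c where "c \<in> A" "p \<in> fst c" by (auto simp: case_prod_beta)
  then show thesis using that[of "fst c" "snd c"] by simp
qed

lemma
  assumes "smooth_atlas A" "(U, \<phi>) \<in> A"
  shows open_chart_image: "open (\<phi> ` U)"
    and chart_inverse: "p \<in> U \<Longrightarrow> inv_into U \<phi> (\<phi> p) = p"
proof -
  have "\<forall>(U, \<phi>)\<in>A. open U \<and> open (\<phi> ` U) \<and> homeomorphism U (\<phi> ` U) \<phi> (inv_into U \<phi>)"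
    using assms(1) unfolding smooth_atlas_def by (elim conjE)
  from bspec[OF this assms(2)]
  have U: "open (\<phi> ` U)" "homeomorphism U (\<phi> ` U) \<phi> (inv_into U \<phi>)" by simp_all
  then show "open (\<phi> ` U)" by simp
  show "p \<in> U \<Longrightarrow> inv_into U \<phi> (\<phi> p) = p"
    using U(2) by (rule homeomorphism_apply1)
qed

lemma smooth_funD: "smooth_fun A f \<Longrightarrow> (U, \<phi>) \<in> A \<Longrightarrow> smooth_on (\<phi> ` U) (f \<circ> inv_into U \<phi>)"
  unfolding smooth_fun_def by (drule (1) bspec) simp

lemma smooth_funI:
  "(\<And>U \<phi>. (U, \<phi>) \<in> A \<Longrightarrow> smooth_on (\<phi> ` U) (f \<circ> inv_into U \<phi>)) \<Longrightarrow> smooth_fun A f"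
  unfolding smooth_fun_def by (rule ballI) (simp add: split_paired_all)

lemma smooth_fun_differentiable:
  "smooth_atlas A \<Longrightarrow> smooth_fun A f \<Longrightarrow> (U, \<phi>) \<in> A \<Longrightarrow> p \<in> U \<Longrightarrow>
    (f \<circ> inv_into U \<phi>) differentiable at (\<phi> p)"
  by (rule smooth_on_differentiable[OF open_chart_image smooth_funD]) auto

lemma smooth_fun_const: "smooth_atlas A \<Longrightarrow> smooth_fun A (\<lambda>_. c)"
  by (intro smooth_funI) (simp add: comp_def smooth_on_const open_chart_image)

lemma smooth_fun_sum_mult:
  assumes "smooth_atlas A" "\<And>i. i \<in> I \<Longrightarrow> smooth_fun A (f i)"
  shows "smooth_fun A (\<lambda>p. \<Sum>i\<in>I. c i * f i p)"
proof (intro smooth_funI)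
  fix U \<phi> assume U: "(U, \<phi>) \<in> A"
  note op = open_chart_image[OF assms(1) U]
  have "smooth_on (\<phi> ` U) (\<lambda>x. \<Sum>i\<in>I. c i * (f i \<circ> inv_into U \<phi>) x)"
    by (intro smooth_on_sum smooth_on_mult smooth_on_const op smooth_funD[OF assms(2) U])
  then show "smooth_on (\<phi> ` U) ((\<lambda>p. \<Sum>i\<in>I. c i * f i p) \<circ> inv_into U \<phi>)"
    by (simp add: comp_def)
qed

lemma vector_field_nonsmooth: "X \<in> vector_fields A \<Longrightarrow> \<not> smooth_fun A f \<Longrightarrow> X f = 0"
  by (simp add: vector_fields_def)

lemma vector_field_chart:
  assumes "X \<in> vector_fields A" "(U, \<phi>) \<in> A"
  obtains v where "smooth_on (\<phi> ` U) v"
    "\<forall>f p. smooth_fun A f \<longrightarrow> p \<in> U \<longrightarrow>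
      X f p = frechet_derivative (f \<circ> inv_into U \<phi>) (at (\<phi> p)) (v (\<phi> p))"
proof -
  from assms(1) have "\<forall>(U, \<phi>)\<in>A. \<exists>v. smooth_on (\<phi> ` U) v \<and>
      (\<forall>f p. smooth_fun A f \<longrightarrow> p \<in> U \<longrightarrow>
        X f p = frechet_derivative (f \<circ> inv_into U \<phi>) (at (\<phi> p)) (v (\<phi> p)))"
    unfolding vector_fields_def mem_Collect_eq by (rule conjunct2)
  from bspec[OF this assms(2)] show thesis
    unfolding prod.case using that by (elim exE conjE)
qed

text \<open>A vector field is real linear, because in a chart it is a Frechet derivative in a fixed direction.\<close>

lemma vector_field_sum_mult:
  assumes A: "smooth_atlas A" and X: "X \<in> vector_fields A"
    and f: "\<And>i. i \<in> I \<Longrightarrow> smooth_fun A (f i)"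
  shows "X (\<lambda>p. \<Sum>i\<in>I. c i * f i p) p = (\<Sum>i\<in>I. c i * X (f i) p)"
proof -
  obtain U \<phi> where U: "(U, \<phi>) \<in> A" "p \<in> U" using chart_at[OF A] .
  obtain v where "smooth_on (\<phi> ` U) v" "\<forall>f p. smooth_fun A f \<longrightarrow> p \<in> U \<longrightarrow>
      X f p = frechet_derivative (f \<circ> inv_into U \<phi>) (at (\<phi> p)) (v (\<phi> p))"
    using vector_field_chart[OF X U(1)] .
  note v = this[rule_format]
  let ?d = "\<lambda>f. frechet_derivative (f \<circ> inv_into U \<phi>) (at (\<phi> p))"
  have "((f i \<circ> inv_into U \<phi>) has_derivative ?d (f i)) (at (\<phi> p))" if "i \<in> I" for i
    using smooth_fun_differentiable[OF A f[OF that] U] by (simp add: frechet_derivative_works)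
  then have "((\<lambda>x. \<Sum>i\<in>I. c i * (f i \<circ> inv_into U \<phi>) x) has_derivative
      (\<lambda>w. \<Sum>i\<in>I. c i * ?d (f i) w)) (at (\<phi> p))"
    by (intro has_derivative_sum has_derivative_mult_right)
  then have "((\<lambda>p. \<Sum>i\<in>I. c i * f i p) \<circ> inv_into U \<phi> has_derivative
      (\<lambda>w. \<Sum>i\<in>I. c i * ?d (f i) w)) (at (\<phi> p))"
    by (simp add: comp_def)
  from frechet_derivative_at[OF this]
  have "?d (\<lambda>p. \<Sum>i\<in>I. c i * f i p) = (\<lambda>w. \<Sum>i\<in>I. c i * ?d (f i) w)" by simp
  then have "X (\<lambda>p. \<Sum>i\<in>I. c i * f i p) p = (\<Sum>i\<in>I. c i * ?d (f i) (v (\<phi> p)))"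
    by (subst v(2)[OF smooth_fun_sum_mult[OF A f] U(2)]) simp_all
  also have "\<dots> = (\<Sum>i\<in>I. c i * X (f i) p)"
    by (rule sum.cong[OF refl]) (simp only: v(2)[OF f U(2)])
  finally show ?thesis .
qed

lemma vector_field_const:
  assumes A: "smooth_atlas A" and X: "X \<in> vector_fields A"
  shows "X (\<lambda>_. c) p = 0"
proof -
  obtain U \<phi> where U: "(U, \<phi>) \<in> A" "p \<in> U" using chart_at[OF A] .
  obtain v where "smooth_on (\<phi> ` U) v" "\<forall>f p. smooth_fun A f \<longrightarrow> p \<in> U \<longrightarrow>
      X f p = frechet_derivative (f \<circ> inv_into U \<phi>) (at (\<phi> p)) (v (\<phi> p))"
    using vector_field_chart[OF X U(1)] .
  note v = this[rule_format]
  have "(\<lambda>_. 0) = frechet_derivative ((\<lambda>_. c) \<circ> inv_into U \<phi>) (at (\<phi> p))"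
    by (rule frechet_derivative_at) (simp add: comp_def)
  from fun_cong[OF this, of "v (\<phi> p)"] show ?thesis
    unfolding v(2)[OF smooth_fun_const[OF A, of c] U(2)] by (rule sym)
qed

lemma fmult_vector_field:
  assumes A: "smooth_atlas A" and h: "smooth_fun A h" and X: "X \<in> vector_fields A"
  shows "h \<cdot>\<^sub>v X \<in> vector_fields A"
  unfolding vector_fields_def
proof (intro CollectI conjI allI impI ballI, goal_cases)
  case (1 f)
  have "X f = 0" by (rule vector_field_nonsmooth[OF X 1])
  then show ?case by (simp add: fmult_def fun_eq_iff)
next
  case (2 c)
  obtain U \<phi> where c: "c = (U, \<phi>)" by (cases c)
  with 2 have U: "(U, \<phi>) \<in> A" by simp
  obtain v where "smooth_on (\<phi> ` U) v" "\<forall>f p. smooth_fun A f \<longrightarrow> p \<in> U \<longrightarrow>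
      X f p = frechet_derivative (f \<circ> inv_into U \<phi>) (at (\<phi> p)) (v (\<phi> p))"
    using vector_field_chart[OF X U] .
  note v = this[rule_format]
  let ?v = "\<lambda>q. (h \<circ> inv_into U \<phi>) q *\<^sub>R v q"
  have "smooth_on (\<phi> ` U) ?v"
    by (intro smooth_on_scaleR open_chart_image[OF A U] smooth_funD[OF h U] v(1))
  moreover have "\<forall>f p. smooth_fun A f \<longrightarrow> p \<in> U \<longrightarrow>
      (h \<cdot>\<^sub>v X) f p = frechet_derivative (f \<circ> inv_into U \<phi>) (at (\<phi> p)) (?v (\<phi> p))"
  proof (intro allI impI)
    fix f p assume f: "smooth_fun A f" "p \<in> U"
    show "(h \<cdot>\<^sub>v X) f p = frechet_derivative (f \<circ> inv_into U \<phi>) (at (\<phi> p)) (?v (\<phi> p))"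
      using linear_frechet_derivative[OF smooth_fun_differentiable[OF A f(1) U f(2)]]
      by (simp add: fmult_def v(2)[OF f] chart_inverse[OF A U f(2)] linear_cmul)
  qed
  ultimately show ?case unfolding c prod.case by (intro exI[of _ ?v] conjI)
qed

lemma add_vector_field:
  assumes A: "smooth_atlas A" and X: "X \<in> vector_fields A" and Y: "Y \<in> vector_fields A"
  shows "X + Y \<in> vector_fields A"
  unfolding vector_fields_def
proof (intro CollectI conjI allI impI ballI, goal_cases)
  case (1 f)
  have "X f = 0" "Y f = 0" by (rule vector_field_nonsmooth[OF X 1] vector_field_nonsmooth[OF Y 1])+
  then show ?case by simp
next
  case (2 c)
  obtain U \<phi> where c: "c = (U, \<phi>)" by (cases c)
  with 2 have U: "(U, \<phi>) \<in> A" by simp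
  obtain v where "smooth_on (\<phi> ` U) v" "\<forall>f p. smooth_fun A f \<longrightarrow> p \<in> U \<longrightarrow>
      X f p = frechet_derivative (f \<circ> inv_into U \<phi>) (at (\<phi> p)) (v (\<phi> p))"
    using vector_field_chart[OF X U] .
  note v = this[rule_format]
  obtain w where "smooth_on (\<phi> ` U) w" "\<forall>f p. smooth_fun A f \<longrightarrow> p \<in> U \<longrightarrow>
      Y f p = frechet_derivative (f \<circ> inv_into U \<phi>) (at (\<phi> p)) (w (\<phi> p))"
    using vector_field_chart[OF Y U] .
  note w = this[rule_format]
  have "smooth_on (\<phi> ` U) (\<lambda>q. v q + w q)"
    by (intro smooth_on_add open_chart_image[OF A U] v(1) w(1))
  moreover have "\<forall>f p. smooth_fun A f \<longrightarrow> p \<in> U \<longrightarrow> (X + Y) f p =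
      frechet_derivative (f \<circ> inv_into U \<phi>) (at (\<phi> p)) (v (\<phi> p) + w (\<phi> p))"
  proof (intro allI impI)
    fix f p assume f: "smooth_fun A f" "p \<in> U"
    show "(X + Y) f p =
        frechet_derivative (f \<circ> inv_into U \<phi>) (at (\<phi> p)) (v (\<phi> p) + w (\<phi> p))"
      using linear_frechet_derivative[OF smooth_fun_differentiable[OF A f(1) U f(2)]]
      by (simp add: v(2)[OF f] w(2)[OF f] linear_add)
  qed
  ultimately show ?case unfolding c prod.case by (intro exI[of _ "\<lambda>q. v q + w q"] conjI)
qed


section \<open>Global frames\<close>

definition frame_field :: "(4 \<Rightarrow> 'm vfield) \<Rightarrow> ('m \<Rightarrow> real^4) \<Rightarrow> 'm vfield" where
  "frame_field e x = (\<lambda>f p. frame_vec e p (x p) f)"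

lemma at_point_frame_field: "at_point (frame_field e x) p = frame_vec e p (x p)"
  by (simp add: at_point_def frame_field_def)

lemma frame_vec_zero: "frame_vec e p 0 = 0"
  by (simp add: frame_vec_def fun_eq_iff)

lemma frame_vec_add: "frame_vec e p (x + y) = frame_vec e p x + frame_vec e p y"
  by (simp add: frame_vec_def fun_eq_iff algebra_simps sum.distrib)

lemma frame_vec_diff: "frame_vec e p (x - y) = frame_vec e p x - frame_vec e p y"
  by (simp add: frame_vec_def fun_eq_iff algebra_simps sum_subtractf)

lemma frame_vec_scaleR: "frame_vec e p (c *\<^sub>R x) f = c * frame_vec e p x f"
  by (simp add: frame_vec_def sum_distrib_left mult.assoc)

lemma frame_vec_axis: "frame_vec e p (axis i 1) = at_point (e i) p"
  by (simp add: frame_vec_def at_point_def axis_def if_distrib[of "\<lambda>u. u * _"] cong: if_cong)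

lemma frame_field_axis: "frame_field e (\<lambda>_. axis i 1) = e i"
  by (simp add: frame_field_def frame_vec_axis at_point_def)

lemma frame_field_add: "frame_field e (\<lambda>p. x p + y p) = frame_field e x + frame_field e y"
  by (simp add: frame_field_def fun_eq_iff frame_vec_add)

lemma frame_field_diff: "frame_field e (\<lambda>p. x p - y p) = frame_field e x - frame_field e y"
  by (simp add: frame_field_def fun_eq_iff frame_vec_diff)

lemma frame_field_eq_sum: "frame_field e x = (\<Sum>i\<in>UNIV. (\<lambda>p. x p $ i) \<cdot>\<^sub>v e i)"
  by (simp add: frame_field_def frame_vec_def fmult_def sum_4 fun_eq_iff)

text \<open>A global frame. Charts take values in \<open>\<real>\<^sup>4\<close>, so the independence at a point makes it a basis of the
  tangent space there.\<close>

locale smooth_frame =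
  fixes A :: "('m::topological_space, real^4) atlas"
    and e :: "4 \<Rightarrow> 'm vfield"
  assumes atlas: "smooth_atlas A"
    and frame_in: "e i \<in> vector_fields A"
    and indep: "frame_vec e p x = 0 \<Longrightarrow> x = 0"
begin

lemma frame_vec_inj: "frame_vec e p x = frame_vec e p y \<longleftrightarrow> x = y"
  using indep[of p "x - y"] by (auto simp: frame_vec_diff)

lemma coords_frame_vec: "coords e p (frame_vec e p x) = x"
  unfolding coords_def by (rule the_equality) (simp_all add: frame_vec_inj)

lemma frame_field_inj:
  assumes "frame_field e x = frame_field e y"
  shows "x = y"
proof
  fix p
  from arg_cong[OF assms, of "\<lambda>X. at_point X p"] show "x p = y p"
    by (simp add: at_point_frame_field frame_vec_inj)
qed

lemma frame_field_in:
  assumes "\<And>i. smooth_fun A (\<lambda>p. x p $ i)"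
  shows "frame_field e x \<in> vector_fields A"
  unfolding frame_field_eq_sum sum_4
  by (intro add_vector_field fmult_vector_field atlas frame_in assms)

lemma const_frame_field_in: "frame_field e (\<lambda>_. c) \<in> vector_fields A"
  by (intro frame_field_in smooth_fun_const atlas)

text \<open>Inside a chart, the frame and a vector field are given by smooth component vectors \<open>w\<^sub>i\<close> and \<open>v\<close>. The
  matrix \<open>M\<close> with columns \<open>w\<^sub>i\<close> is invertible, since a vector in its kernel is a relation between the
  \<open>e\<^sub>i\<close> at that point. Cramer's rule then solves \<open>M y = v\<close> by a smooth \<open>y\<close>.\<close>

lemma chart_components:
  assumes X: "X \<in> vector_fields A" and U: "(U, \<phi>) \<in> A"
  obtains y where "\<forall>k. smooth_on (\<phi> ` U) (\<lambda>q. y q $ k)"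
    "\<forall>p\<in>U. at_point X p = frame_vec e p (y (\<phi> p))"
proof -
  let ?d = "\<lambda>f p. frechet_derivative (f \<circ> inv_into U \<phi>) (at (\<phi> p))"
  obtain v where "smooth_on (\<phi> ` U) v"
    "\<forall>f p. smooth_fun A f \<longrightarrow> p \<in> U \<longrightarrow> X f p = ?d f p (v (\<phi> p))"
    using vector_field_chart[OF X U] .
  note v = this[rule_format]
  have "\<forall>i. \<exists>w. smooth_on (\<phi> ` U) w \<and>
      (\<forall>f p. smooth_fun A f \<longrightarrow> p \<in> U \<longrightarrow> e i f p = ?d f p (w (\<phi> p)))"
    by (rule allI, rule vector_field_chart[OF frame_in U]) (intro exI conjI)
  from choice[OF this] obtain w where "\<forall>i. smooth_on (\<phi> ` U) (w i) \<and>
      (\<forall>f p. smooth_fun A f \<longrightarrow> p \<in> U \<longrightarrow> e i f p = ?d f p (w i (\<phi> p)))" ..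
  then have w: "\<And>i. smooth_on (\<phi> ` U) (w i)"
    "\<And>i f p. smooth_fun A f \<Longrightarrow> p \<in> U \<Longrightarrow> e i f p = ?d f p (w i (\<phi> p))" by simp_all
  define M where "M q = (\<chi> r c. w c q $ r)" for q
  have Mv: "M q *v c = (\<Sum>i\<in>UNIV. c $ i *\<^sub>R w i q)" for q c
    by (simp add: M_def vec_eq_iff matrix_vector_mult_def mult.commute)
  have fv: "frame_vec e p c f = ?d f p (M (\<phi> p) *v c)" if "smooth_fun A f" "p \<in> U" for p c f
    using linear_frechet_derivative[OF smooth_fun_differentiable[OF atlas that(1) U that(2)]]
    by (simp add: frame_vec_def Mv w(2)[OF that] linear_sum linear_cmul)
  have fv0: "frame_vec e p c f = 0" if "\<not> smooth_fun A f" for p c f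
    using vector_field_nonsmooth[OF frame_in that] by (simp add: frame_vec_def)
  have det: "det (M (\<phi> p)) \<noteq> 0" if p: "p \<in> U" for p
  proof -
    have "c = 0" if c: "M (\<phi> p) *v c = 0" for c
    proof (rule indep)
      show "frame_vec e p c = 0"
      proof
        fix f
        show "frame_vec e p c f = 0 f"
        proof (cases "smooth_fun A f")
          case True
          show ?thesis
            using linear_frechet_derivative[OF smooth_fun_differentiable[OF atlas True U p]]
            by (simp add: fv[OF True p] c linear_0)
        qed (simp add: fv0)
      qed
    qed
    then have "invertible (M (\<phi> p))"
      by (simp add: invertible_left_inverse matrix_left_invertible_ker)
    then show ?thesis by (simp add: invertible_det_nz)
  qed
  define y where "y q = (\<chi> k. det (\<chi> i j. if j = k then v q $ i else M q $ i $ j) / det (M q))" for q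
  note op = open_chart_image[OF atlas U]
  have "smooth_on (\<phi> ` U) (\<lambda>q. y q $ k)" for k
    unfolding y_def vec_lambda_beta
  proof (intro smooth_on_divide smooth_on_det op)
    fix i j
    show M: "smooth_on (\<phi> ` U) (\<lambda>q. M q $ i $ j)"
      by (simp add: M_def smooth_on_nth[OF op] w)
    show "smooth_on (\<phi> ` U) (\<lambda>q. (\<chi> i j. if j = k then v q $ i else M q $ i $ j) $ i $ j)"
      using M by (cases "j = k") (simp_all add: smooth_on_nth[OF op] v)
  qed (use det in auto)
  moreover have "at_point X p = frame_vec e p (y (\<phi> p))" if p: "p \<in> U" for p
  proof
    fix f
    have "M (\<phi> p) *v y (\<phi> p) = v (\<phi> p)"
      unfolding cramer[OF det[OF p]] y_def ..
    then show "at_point X p f = frame_vec e p (y (\<phi> p)) f"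
      using vector_field_nonsmooth[OF X, of f]
      by (cases "smooth_fun A f") (simp_all add: at_point_def fv fv0 v(2) p)
  qed
  ultimately show thesis by (intro that allI ballI)
qed

text \<open>The local solutions given by Cramer's rule agree with the pointwise coordinates, hence glue.\<close>

lemma vector_field_components:
  assumes X: "X \<in> vector_fields A"
  obtains x where "\<forall>i. smooth_fun A (\<lambda>p. x p $ i)" "X = frame_field e x"
proof -
  define x where "x p = coords e p (at_point X p)" for p
  have chart: "smooth_on (\<phi> ` U) ((\<lambda>p. x p $ i) \<circ> inv_into U \<phi>) \<and>
      (\<forall>p\<in>U. at_point X p = frame_vec e p (x p))" if U: "(U, \<phi>) \<in> A" for U \<phi> i
  proof -
    obtain y where y: "\<forall>k. smooth_on (\<phi> ` U) (\<lambda>q. y q $ k)"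
      "\<forall>p\<in>U. at_point X p = frame_vec e p (y (\<phi> p))"
      using chart_components[OF X U] .
    have xy: "x p = y (\<phi> p)" if "p \<in> U" for p
      unfolding x_def y(2)[rule_format, OF that] by (rule coords_frame_vec)
    have "smooth_on (\<phi> ` U) ((\<lambda>p. x p $ i) \<circ> inv_into U \<phi>)"
    proof (rule smooth_on_cong[OF open_chart_image[OF atlas U] _ y(1)[rule_format, of i]])
      fix q assume "q \<in> \<phi> ` U"
      then obtain p where "p \<in> U" "q = \<phi> p" by auto
      then show "y q $ i = ((\<lambda>p. x p $ i) \<circ> inv_into U \<phi>) q"
        by (simp add: chart_inverse[OF atlas U] xy)
    qed
    with y(2) xy show ?thesis by simp
  qed
  have "smooth_fun A (\<lambda>p. x p $ i)" for i
    using chart by (intro smooth_funI) simp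
  moreover have "X = frame_field e x"
  proof (intro ext)
    fix f p
    obtain U \<phi> where U: "(U, \<phi>) \<in> A" "p \<in> U" using chart_at[OF atlas] .
    from chart[OF U(1)] U(2) have "at_point X p = frame_vec e p (x p)" by blast
    from fun_cong[OF this, of f] show "X f p = frame_field e x f p"
      by (simp add: frame_field_def at_point_def)
  qed
  ultimately show thesis by (intro that allI)
qed

end

text \<open>A relation between left-invariant fields at one point is carried by left translations to every
  other point, so it is a relation in the Lie algebra, where the \<open>e\<^sub>i\<close> are independent.\<close>

lemma lie_algebra_basis_imp_smooth_frame:
  assumes L: "lie_group L A" and e: "lie_algebra_basis L A e"
  shows "smooth_frame A e"
proof
  show atlas: "smooth_atlas A" using L by (simp add: lie_group_def)
  have eL: "e i \<in> lie_algebra L A" for i using e by (simp add: lie_algebra_basis_def)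
  then show ein: "e i \<in> vector_fields A" for i by (simp add: lie_algebra_def)
  have inv: "e i (\<lambda>q. f (r \<otimes>\<^bsub>L\<^esub> q)) q = e i f (r \<otimes>\<^bsub>L\<^esub> q)" if "smooth_fun A f" for i f q r
    using eL[of i] that by (simp add: lie_algebra_def left_invariant_def)
  interpret group L using L by (simp add: lie_group_def)
  have carr: "carrier L = UNIV" using L by (simp add: lie_group_def)
  fix p x assume x: "frame_vec e p x = 0"
  \<comment> \<open>The hypothesis on \<open>x\<close> is an equality of operators on all functions, so it can be evaluated
    at \<open>f\<close> composed with a translation.\<close>
  have zero: "frame_vec e q x f = 0" for q f
  proof (cases "smooth_fun A f")
    case True
    let ?r = "q \<otimes>\<^bsub>L\<^esub> inv\<^bsub>L\<^esub> p"
    have "?r \<otimes>\<^bsub>L\<^esub> p = q" by (simp add: m_assoc carr)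
    then have "frame_vec e q x f = frame_vec e p x (\<lambda>s. f (?r \<otimes>\<^bsub>L\<^esub> s))"
      by (simp add: frame_vec_def inv[OF True])
    then show ?thesis by (simp add: x)
  next
    case False
    then show ?thesis by (simp add: frame_vec_def vector_field_nonsmooth[OF ein])
  qed
  have "\<exists>!c :: real^4. e 1 = frame_field e (\<lambda>_. c)"
    using e eL[of 1] unfolding lie_algebra_basis_def frame_field_eq_sum by blast
  moreover have "e 1 = frame_field e (\<lambda>_. axis 1 1)"
    by (simp add: frame_field_axis)
  moreover have "frame_field e (\<lambda>_. axis 1 1 + x) = frame_field e (\<lambda>_. axis 1 1)"
    by (simp add: frame_field_add) (simp add: frame_field_def fun_eq_iff zero)
  ultimately have "axis 1 1 + x = axis 1 1" by metis
  then show "x = 0" by simp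
qed


section \<open>The Levi-Civita connection in the frame\<close>

lemma vector_4:
  "(vector [x, y, z, w] :: ('a::zero)^4) $ 1 = x"
  "(vector [x, y, z, w] :: ('a::zero)^4) $ 2 = y"
  "(vector [x, y, z, w] :: ('a::zero)^4) $ 3 = z"
  "(vector [x, y, z, w] :: ('a::zero)^4) $ 4 = w"
  unfolding vector_def by simp_all

definition neutral_form :: "real^4 \<Rightarrow> real^4 \<Rightarrow> real" where
  "neutral_form x y = x $ 1 * y $ 1 + x $ 2 * y $ 2 - x $ 3 * y $ 3 - x $ 4 * y $ 4"

text \<open>Since \<open>ad e\<^sub>4\<close> acts on \<open>e\<^sub>1, e\<^sub>2, e\<^sub>3\<close> by scalars, the Koszul formula gives, with
  \<open>\<lambda> = (1, a, b)\<close> and \<open>\<epsilon> = (1, 1, -1)\<close>: \<open>\<nabla> e\<^sub>i e\<^sub>4 = \<lambda>\<^sub>i e\<^sub>i\<close> and \<open>\<nabla> e\<^sub>i e\<^sub>i = \<epsilon>\<^sub>i \<lambda>\<^sub>i e\<^sub>4\<close> for \<open>i < 4\<close>; all other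
  derivatives \<open>\<nabla> e\<^sub>i e\<^sub>j\<close> vanish.\<close>

definition christoffel :: "real \<Rightarrow> real \<Rightarrow> real^4 \<Rightarrow> real^4 \<Rightarrow> real^4" where
  "christoffel a b x y = vector [x $ 1 * y $ 4, a * (x $ 2 * y $ 4), b * (x $ 3 * y $ 4),
     x $ 1 * y $ 1 + a * (x $ 2 * y $ 2) - b * (x $ 3 * y $ 3)]"

lemma christoffel_nth:
  "christoffel a b x y $ 1 = x $ 1 * y $ 4"
  "christoffel a b x y $ 2 = a * (x $ 2 * y $ 4)"
  "christoffel a b x y $ 3 = b * (x $ 3 * y $ 4)"
  "christoffel a b x y $ 4 = x $ 1 * y $ 1 + a * (x $ 2 * y $ 2) - b * (x $ 3 * y $ 3)"
  by (simp_all add: christoffel_def vector_4)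

lemma vec4_eq_iff:
  fixes x y :: "'a^4"
  shows "x = y \<longleftrightarrow> x $ 1 = y $ 1 \<and> x $ 2 = y $ 2 \<and> x $ 3 = y $ 3 \<and> x $ 4 = y $ 4"
  by (simp add: vec_eq_iff forall_4)

lemma axis4_nth:
  "(axis 1 c :: ('a::zero)^4) $ 1 = c" "(axis 1 c :: ('a::zero)^4) $ 2 = 0"
  "(axis 1 c :: ('a::zero)^4) $ 3 = 0" "(axis 1 c :: ('a::zero)^4) $ 4 = 0"
  "(axis 2 c :: ('a::zero)^4) $ 1 = 0" "(axis 2 c :: ('a::zero)^4) $ 2 = c"
  "(axis 2 c :: ('a::zero)^4) $ 3 = 0" "(axis 2 c :: ('a::zero)^4) $ 4 = 0"
  "(axis 3 c :: ('a::zero)^4) $ 1 = 0" "(axis 3 c :: ('a::zero)^4) $ 2 = 0"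
  "(axis 3 c :: ('a::zero)^4) $ 3 = c" "(axis 3 c :: ('a::zero)^4) $ 4 = 0"
  "(axis 4 c :: ('a::zero)^4) $ 1 = 0" "(axis 4 c :: ('a::zero)^4) $ 2 = 0"
  "(axis 4 c :: ('a::zero)^4) $ 3 = 0" "(axis 4 c :: ('a::zero)^4) $ 4 = c"
  by (simp_all add: axis_def)

lemma christoffel_metric:
  "neutral_form (christoffel a b x y) z + neutral_form y (christoffel a b x z) = 0"
  by (simp add: neutral_form_def christoffel_nth algebra_simps)

lemma neutral_form_diff_left: "neutral_form (x - y) z = neutral_form x z - neutral_form y z"
  by (simp add: neutral_form_def algebra_simps)

lemma neutral_form_commute: "neutral_form x y = neutral_form y x"
  by (simp add: neutral_form_def mult.commute)

lemma neutral_form_eq_zeroD: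
  assumes "\<And>k. neutral_form x (axis k 1) = 0"
  shows "x = 0"
  using assms[of 1] assms[of 2] assms[of 3] assms[of 4]
  by (simp add: neutral_form_def axis4_nth vec4_eq_iff)

text \<open>The algebra behind the uniqueness of the Levi-Civita connection: the difference of two metric
  connections with equal torsion, with its index lowered, is symmetric in the first two arguments and
  skew in the last two.\<close>

lemma skew_and_symmetric_imp_zero:
  fixes d :: "'i \<Rightarrow> 'i \<Rightarrow> 'i \<Rightarrow> real"
  assumes sym: "\<And>i j k. d i j k = d j i k" and skew: "\<And>i j k. d i j k = - d i k j"
  shows "d i j k = 0"
proof -
  have "d i j k = - d i k j" by (rule skew)
  also have "\<dots> = - d k i j" by (simp only: sym[of i k j])
  also have "\<dots> = d k j i" by (simp only: skew[of k i j] minus_minus)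
  also have "\<dots> = d j k i" by (rule sym)
  also have "\<dots> = - d j i k" by (rule skew)
  also have "\<dots> = - d i j k" by (simp only: sym[of j i k])
  finally show ?thesis by simp
qed

lemma bracket_commute: "bracket X Y = - bracket Y X"
  by (simp add: bracket_def fun_eq_iff)

lemma bracket_self: "bracket X X = 0"
  by (simp add: bracket_def fun_eq_iff)

context smooth_frame
begin

lemma neutral_metric_frame_field:
  "neutral_metric e (frame_field e x) (frame_field e y) = (\<lambda>p. neutral_form (x p) (y p))"
  by (simp add: neutral_metric_def neutral_metric_at_def Let_def at_point_frame_field coords_frame_vec
      neutral_form_def)

lemma neutral_metric_at_frame_vec:
  "neutral_metric_at e p (frame_vec e p x) (frame_vec e p y) = neutral_form x y"
  by (simp add: neutral_metric_at_def Let_def coords_frame_vec neutral_form_def)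

end

locale g45_frame = smooth_frame A e for A :: "('m::topological_space, real^4) atlas" and e +
  fixes a b :: real and D :: "'m vfield \<Rightarrow> 'm vfield \<Rightarrow> 'm vfield"
  assumes bracket14: "bracket (e 1) (e 4) = e 1"
    and bracket24: "bracket (e 2) (e 4) = (\<lambda>_. a) \<cdot>\<^sub>v e 2"
    and bracket34: "bracket (e 3) (e 4) = (\<lambda>_. b) \<cdot>\<^sub>v e 3"
    and bracket12: "bracket (e 1) (e 2) = 0" and bracket13: "bracket (e 1) (e 3) = 0"
    and bracket23: "bracket (e 2) (e 3) = 0"
    and lc: "levi_civita A (neutral_metric e) D"
begin

abbreviation \<Gamma> where "\<Gamma> \<equiv> christoffel a b"

lemma bracket_frame:
  "bracket (e i) (e j) =
    frame_field e (\<lambda>_. \<Gamma> (axis i 1) (axis j 1) - \<Gamma> (axis j 1) (axis i 1))"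
proof -
  have c: "frame_field e (\<lambda>_. c) f p = c $ 1 * e 1 f p + c $ 2 * e 2 f p + c $ 3 * e 3 f p + c $ 4 * e 4 f p"
    for c f p by (simp add: frame_field_def frame_vec_def sum_4)
  have "\<forall>i j. bracket (e i) (e j) =
      frame_field e (\<lambda>_. \<Gamma> (axis i 1) (axis j 1) - \<Gamma> (axis j 1) (axis i 1))"
    unfolding forall_4
    by (intro conjI ext; simp only: bracket_self bracket14 bracket24 bracket34 bracket12 bracket13
        bracket23 bracket_commute[of "e 4"] bracket_commute[of "e 3" "e 2"]
        bracket_commute[of "e 3" "e 1"] bracket_commute[of "e 2" "e 1"];
      simp add: c fmult_def christoffel_nth axis4_nth)
  then show ?thesis by blast
qed

lemma
  assumes "X \<in> vector_fields A" "Y \<in> vector_fields A"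
  shows D_in: "D X Y \<in> vector_fields A"
    and D_torsion: "D X Y - D Y X = bracket X Y"
    and D_metric: "Z \<in> vector_fields A \<Longrightarrow>
      X (neutral_metric e Y Z) = neutral_metric e (D X Y) Z + neutral_metric e Y (D X Z)"
    and D_add_left: "Z \<in> vector_fields A \<Longrightarrow> D (X + Y) Z = D X Z + D Y Z"
    and D_add_right: "Z \<in> vector_fields A \<Longrightarrow> D X (Y + Z) = D X Y + D X Z"
    and D_fmult_left: "smooth_fun A f \<Longrightarrow> D (f \<cdot>\<^sub>v X) Y = f \<cdot>\<^sub>v D X Y"
    and D_fmult_right: "smooth_fun A f \<Longrightarrow> D X (f \<cdot>\<^sub>v Y) = X f \<cdot>\<^sub>v Y + f \<cdot>\<^sub>v D X Y"
  using lc assms unfolding levi_civita_def affine_connection_def by (simp_all add: plus_fun_def)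

text \<open>Both \<open>D\<close> and \<open>christoffel\<close> are metric and have the brackets of the frame as torsion, so their
  difference vanishes.\<close>

lemma D_frame: "D (e i) (e j) = frame_field e (\<lambda>_. \<Gamma> (axis i 1) (axis j 1))"
proof -
  have "\<forall>i. \<exists>\<gamma>. \<forall>j. D (e i) (e j) = frame_field e (\<gamma> j)"
    by (intro allI choice) (rule vector_field_components[OF D_in[OF frame_in frame_in]], rule exI)
  from choice[OF this] obtain \<gamma> where "\<forall>i j. D (e i) (e j) = frame_field e (\<gamma> i j)" ..
  then have \<gamma>: "D (e i) (e j) = frame_field e (\<gamma> i j)" for i j by simp
  let ?\<Gamma> = "\<lambda>i j. \<Gamma> (axis i 1) (axis j 1)"
  have "\<gamma> i j p - ?\<Gamma> i j = 0" for i j p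
  proof (rule neutral_form_eq_zeroD)
    fix k
    let ?d = "\<lambda>i j k. neutral_form (\<gamma> i j p - ?\<Gamma> i j) (axis k 1)"
    show "?d i j k = 0"
    proof (rule skew_and_symmetric_imp_zero[of ?d])
      fix i j k
      have "frame_field e (\<lambda>p. \<gamma> i j p - \<gamma> j i p) = frame_field e (\<lambda>_. ?\<Gamma> i j - ?\<Gamma> j i)"
        unfolding frame_field_diff[of e "\<gamma> i j"] \<gamma>[symmetric] D_torsion[OF frame_in frame_in]
        by (rule bracket_frame)
      from fun_cong[OF frame_field_inj[OF this], of p]
      have "\<gamma> i j p - ?\<Gamma> i j = \<gamma> j i p - ?\<Gamma> j i" by (simp add: algebra_simps)
      then show "?d i j k = ?d j i k" by simp
      have const: "neutral_metric e (e j) (e k) = (\<lambda>_. neutral_form (axis j 1) (axis k 1))"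
        by (simp add: neutral_metric_frame_field flip: frame_field_axis[of e])
      have "0 = e i (neutral_metric e (e j) (e k)) p"
        unfolding const by (rule vector_field_const[OF atlas frame_in, symmetric])
      also have "\<dots> = neutral_metric e (frame_field e (\<gamma> i j)) (frame_field e (\<lambda>_. axis k 1)) p
          + neutral_metric e (frame_field e (\<lambda>_. axis j 1)) (frame_field e (\<gamma> i k)) p"
        unfolding D_metric[OF frame_in frame_in frame_in] \<gamma> frame_field_axis by simp
      also have "\<dots> = neutral_form (\<gamma> i j p) (axis k 1) + neutral_form (\<gamma> i k p) (axis j 1)"
        by (simp add: neutral_metric_frame_field neutral_form_commute[of "axis j 1"])
      finally show "?d i j k = - ?d i k j"
        using christoffel_metric[of a b "axis i 1" "axis j 1" "axis k 1"]
        by (simp add: neutral_form_diff_left neutral_form_commute[of "axis j 1"])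
    qed
  qed
  then have "\<gamma> i j = (\<lambda>_. ?\<Gamma> i j)" by (simp add: fun_eq_iff)
  then show ?thesis by (simp add: \<gamma>)
qed

text \<open>The additivity and the Leibniz rule of \<open>D\<close> reduce every covariant derivative to those of the frame.\<close>

lemma D_frame_field:
  assumes x: "\<And>i. smooth_fun A (\<lambda>p. x p $ i)" and y: "\<And>i. smooth_fun A (\<lambda>p. y p $ i)"
  shows "D (frame_field e x) (frame_field e y) =
    frame_field e (\<lambda>p. (\<chi> k. frame_field e x (\<lambda>q. y q $ k) p) + \<Gamma> (x p) (y p))"
proof -
  let ?X = "frame_field e x"
  note X = frame_field_in[OF x]
  note ins = add_vector_field fmult_vector_field atlas frame_in x y X
  have DX: "D ?X (e j) = (\<Sum>i\<in>UNIV. (\<lambda>p. x p $ i) \<cdot>\<^sub>v D (e i) (e j))" for j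
    unfolding frame_field_eq_sum sum_4
    by (simp only: D_add_left D_fmult_left ins)
  have "D ?X (frame_field e y) = (\<Sum>j\<in>UNIV. ?X (\<lambda>p. y p $ j) \<cdot>\<^sub>v e j + (\<lambda>p. y p $ j) \<cdot>\<^sub>v D ?X (e j))"
    unfolding frame_field_eq_sum[of e y] sum_4
    by (simp only: D_add_right D_fmult_right ins)
  also have "\<dots> = frame_field e (\<lambda>p. (\<chi> k. ?X (\<lambda>q. y q $ k) p) + \<Gamma> (x p) (y p))"
    unfolding DX D_frame
    by (intro ext) (simp add: sum_4 frame_field_def frame_vec_def fmult_def christoffel_nth
        axis4_nth algebra_simps)
  finally show ?thesis .
qed

lemma D_const:
  "D (frame_field e (\<lambda>_. x)) (frame_field e (\<lambda>_. y)) = frame_field e (\<lambda>_. \<Gamma> x y)"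
proof -
  have "(\<chi> k. frame_field e (\<lambda>_. x) (\<lambda>q. y $ k) p) = 0" for p
    by (simp add: vec_eq_iff vector_field_const[OF atlas const_frame_field_in])
  then show ?thesis
    by (simp add: D_frame_field smooth_fun_const atlas)
qed

end


section \<open>The almost complex structures in the frame\<close>

definition J_lin :: "3 \<Rightarrow> real^4 \<Rightarrow> real^4" where
  "J_lin \<alpha> x = (\<Sum>i\<in>UNIV. x $ i *\<^sub>R (J_basis $ \<alpha> $ i))"

lemma J_lin_nth:
  "J_lin 1 x $ 1 = - x $ 2" "J_lin 1 x $ 2 = x $ 1" "J_lin 1 x $ 3 = x $ 4" "J_lin 1 x $ 4 = - x $ 3"
  "J_lin 2 x $ 1 = - x $ 3" "J_lin 2 x $ 2 = - x $ 4" "J_lin 2 x $ 3 = x $ 1" "J_lin 2 x $ 4 = x $ 2"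
  "J_lin 3 x $ 1 = x $ 4" "J_lin 3 x $ 2 = - x $ 3" "J_lin 3 x $ 3 = x $ 2" "J_lin 3 x $ 4 = - x $ 1"
  by (simp_all add: J_lin_def J_basis_def sum_4 vector_3 vector_4 axis4_nth)

lemma linear_J_lin: "linear (J_lin \<alpha>)"
  by (rule linearI) (simp_all add: J_lin_def sum.distrib scaleR_add_left scaleR_sum_right)

lemma J_lin_nth_sum: "J_lin \<alpha> x $ k = (\<Sum>i\<in>UNIV. J_basis $ \<alpha> $ i $ k * x $ i)"
  by (simp add: J_lin_def mult.commute)

lemma J_lin_J_lin: "J_lin \<alpha> (J_lin \<alpha> x) = - x"
  using exhaust_3[of \<alpha>] by (auto simp: vec4_eq_iff J_lin_nth)

lemma J_lin_axis_diag: "J_lin \<alpha> (axis i 1) $ i = 0"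
  using exhaust_3[of \<alpha>] exhaust_4[of i] by (auto simp: J_lin_nth axis4_nth)

lemma J_lin_axis_pair:
  assumes "J_lin \<alpha> (axis i 1) $ j \<noteq> 0"
  shows "J_lin \<alpha> (axis i 1) = J_lin \<alpha> (axis i 1) $ j *\<^sub>R axis j 1"
    and "J_lin \<alpha> (axis j 1) = - (J_lin \<alpha> (axis i 1) $ j) *\<^sub>R axis i 1"
  using assms exhaust_3[of \<alpha>] exhaust_4[of i] exhaust_4[of j]
  by (auto simp: vec4_eq_iff J_lin_nth axis4_nth)

definition coord_plane :: "4 \<Rightarrow> 4 \<Rightarrow> (real^4) set" where
  "coord_plane i j = {c *\<^sub>R axis i 1 + d *\<^sub>R axis j 1 | c d. True}"

lemma coord_planeI: "c *\<^sub>R axis i 1 + d *\<^sub>R axis j 1 \<in> coord_plane i j"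
  unfolding coord_plane_def by blast

text \<open>Each \<open>J\<^sub>\<alpha>\<close> permutes the coordinate axes in two pairs, up to sign. A coordinate plane is invariant
  if its axes form such a pair; otherwise \<open>J\<^sub>\<alpha>\<close> maps its first axis out of it.\<close>

lemma coord_plane_J_invariant_iff:
  assumes ij: "i \<noteq> j"
  shows "coord_plane i j = J_lin \<alpha> ` coord_plane i j \<longleftrightarrow> J_lin \<alpha> (axis i 1) $ j \<noteq> 0"
proof
  assume inv: "coord_plane i j = J_lin \<alpha> ` coord_plane i j"
  have "axis i 1 \<in> coord_plane i j" using coord_planeI[of 1 i 0 j] by simp
  then have "J_lin \<alpha> (axis i 1) \<in> coord_plane i j" by (subst inv) (rule imageI)
  then obtain c d where cd: "J_lin \<alpha> (axis i 1) = c *\<^sub>R axis i 1 + d *\<^sub>R axis j 1"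
    unfolding coord_plane_def by blast
  show "J_lin \<alpha> (axis i 1) $ j \<noteq> 0"
  proof
    assume "J_lin \<alpha> (axis i 1) $ j = 0"
    with cd ij J_lin_axis_diag[of \<alpha> i] have "c = 0" "d = 0"
      by (simp_all add: axis_def)
    with cd have "J_lin \<alpha> (axis i 1) = 0" by simp
    with J_lin_J_lin[of \<alpha> "axis i 1"] linear_0[OF linear_J_lin[of \<alpha>]] show False
      by (simp add: axis_eq_0_iff)
  qed
next
  assume s: "J_lin \<alpha> (axis i 1) $ j \<noteq> 0"
  have closed: "J_lin \<alpha> x \<in> coord_plane i j" if "x \<in> coord_plane i j" for x
  proof -
    from that obtain c d where x: "x = c *\<^sub>R axis i 1 + d *\<^sub>R axis j 1"
      unfolding coord_plane_def by blast
    have "J_lin \<alpha> x = c *\<^sub>R J_lin \<alpha> (axis i 1) + d *\<^sub>R J_lin \<alpha> (axis j 1)"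
      by (simp add: x linear_add[OF linear_J_lin] linear_cmul[OF linear_J_lin])
    also have "\<dots> = (- (d * J_lin \<alpha> (axis i 1) $ j)) *\<^sub>R axis i 1
        + (c * J_lin \<alpha> (axis i 1) $ j) *\<^sub>R axis j 1"
      by (subst J_lin_axis_pair(2)[OF s], subst J_lin_axis_pair(1)[OF s]) simp
    finally show ?thesis by (simp only: coord_planeI)
  qed
  have "x \<in> J_lin \<alpha> ` coord_plane i j" if "x \<in> coord_plane i j" for x
  proof
    show "x = J_lin \<alpha> (J_lin \<alpha> (J_lin \<alpha> (J_lin \<alpha> x)))" by (simp add: J_lin_J_lin)
    show "J_lin \<alpha> (J_lin \<alpha> (J_lin \<alpha> x)) \<in> coord_plane i j" by (intro closed that)
  qed
  with closed show "coord_plane i j = J_lin \<alpha> ` coord_plane i j" by blast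
qed

lemma coord_plane_J_orthogonal:
  assumes "i \<noteq> j" "J_lin \<alpha> (axis i 1) $ j = 0" "s \<in> coord_plane i j" "t \<in> coord_plane i j"
  shows "neutral_form s (J_lin \<alpha> t) = 0"
proof -
  obtain c d where s: "s = c *\<^sub>R axis i 1 + d *\<^sub>R axis j 1"
    using assms(3) unfolding coord_plane_def by blast
  obtain c' d' where t: "t = c' *\<^sub>R axis i 1 + d' *\<^sub>R axis j 1"
    using assms(4) unfolding coord_plane_def by blast
  show ?thesis
    using assms(1,2) exhaust_3[of \<alpha>] exhaust_4[of i] exhaust_4[of j]
    by (elim disjE) (simp_all add: s t neutral_form_def J_lin_nth axis4_nth)
qed


section \<open>Nijenhuis tensors\<close>

text \<open>In \<open>D\<^sub>X (J Y) - J (D\<^sub>X Y)\<close> the derivatives of the components of \<open>Y\<close> cancel, because \<open>J\<close> has constant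
  components. What remains is algebraic in the values of \<open>X\<close> and \<open>Y\<close>; so is the Nijenhuis tensor.\<close>

definition nabla_J_lin :: "real \<Rightarrow> real \<Rightarrow> 3 \<Rightarrow> real^4 \<Rightarrow> real^4 \<Rightarrow> real^4" where
  "nabla_J_lin a b \<alpha> x y = christoffel a b x (J_lin \<alpha> y) - J_lin \<alpha> (christoffel a b x y)"

definition nijenhuis_lin :: "real \<Rightarrow> real \<Rightarrow> 3 \<Rightarrow> real^4 \<Rightarrow> real^4 \<Rightarrow> real^4" where
  "nijenhuis_lin a b \<alpha> x y =
     nabla_J_lin a b \<alpha> x (J_lin \<alpha> y) - nabla_J_lin a b \<alpha> y (J_lin \<alpha> x)
     + nabla_J_lin a b \<alpha> (J_lin \<alpha> x) y - nabla_J_lin a b \<alpha> (J_lin \<alpha> y) x"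

text \<open>The component of \<open>e\<^sub>2\<close> in \<open>N\<^sub>1(e\<^sub>1, e\<^sub>3)\<close> forces \<open>a = 1\<close>, and that of \<open>e\<^sub>3\<close> in \<open>N\<^sub>2(e\<^sub>1, e\<^sub>2)\<close> forces
  \<open>b = 1\<close>. Conversely, for \<open>a = b = 1\<close> the bracket is \<open>[x, y] = y\<^sup>4 x - x\<^sup>4 y\<close>, and for such a bracket
  \<open>[J x, J y] - J [J x, y] - J [x, J y] - [x, y]\<close> vanishes for every linear \<open>J\<close> with \<open>J\<^sup>2 = -1\<close>.\<close>

lemma nijenhuis_lin_vanishes_iff:
  "(\<forall>\<alpha> x y. nijenhuis_lin a b \<alpha> x y = 0) \<longleftrightarrow> a = 1 \<and> b = 1"
proof
  assume N: "\<forall>\<alpha> x y. nijenhuis_lin a b \<alpha> x y = 0"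
  have "nijenhuis_lin a b 1 (axis 1 1) (axis 3 1) $ 2 = 1 - a"
    "nijenhuis_lin a b 2 (axis 1 1) (axis 2 1) $ 3 = b - 1"
    by (simp_all add: nijenhuis_lin_def nabla_J_lin_def christoffel_nth J_lin_nth axis4_nth)
  with N show "a = 1 \<and> b = 1" by simp
next
  assume ab: "a = 1 \<and> b = 1"
  show "\<forall>\<alpha> x y. nijenhuis_lin a b \<alpha> x y = 0"
    unfolding forall_3
    by (simp add: ab nijenhuis_lin_def nabla_J_lin_def christoffel_nth J_lin_nth vec4_eq_iff
        algebra_simps)
qed


section \<open>Curvature\<close>

text \<open>The curvature on fields with constant components. As the connection has no torsion, their bracket is
  \<open>\<Gamma> x y - \<Gamma> y x\<close>.\<close>

definition curv_lin :: "real \<Rightarrow> real \<Rightarrow> real^4 \<Rightarrow> real^4 \<Rightarrow> real^4 \<Rightarrow> real^4" where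
  "curv_lin a b x y z = christoffel a b x (christoffel a b y z) - christoffel a b y (christoffel a b x z)
     - christoffel a b (christoffel a b x y - christoffel a b y x) z"

lemmas curv_lin_simps = curv_lin_def christoffel_nth axis4_nth neutral_form_def

context smooth_frame
begin

lemma J_at_frame_vec: "J_at e \<alpha> p (frame_vec e p x) = frame_vec e p (J_lin \<alpha> x)"
  by (simp add: J_at_def coords_frame_vec J_lin_def)

lemma J_field_frame_field: "J_field e \<alpha> (frame_field e x) = frame_field e (\<lambda>p. J_lin \<alpha> (x p))"
  by (simp add: J_field_def at_point_frame_field J_at_frame_vec) (simp add: frame_field_def)

lemma basic_plane_eq: "basic_plane e p i j = frame_vec e p ` coord_plane i j"
proof -
  have "frame_vec e p (c *\<^sub>R axis i 1 + d *\<^sub>R axis j 1) = (\<lambda>f. c * e i f p + d * e j f p)" for c d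
    by (simp add: fun_eq_iff frame_vec_add frame_vec_scaleR frame_vec_axis at_point_def)
  then show ?thesis unfolding basic_plane_def coord_plane_def by (auto simp: image_iff) metis+
qed

lemma J_at_basic_plane:
  "J_at e \<alpha> p ` basic_plane e p i j = frame_vec e p ` J_lin \<alpha> ` coord_plane i j"
  by (simp add: basic_plane_eq image_image J_at_frame_vec)

text \<open>The coordinates at \<open>p\<close> turn the condition on the tangent plane into one on a coordinate plane of
  \<open>\<real>\<^sup>4\<close>, the same for every \<open>p\<close>.\<close>

lemma holomorphic_basic_plane_iff:
  assumes "i \<noteq> j"
  shows "holomorphic_plane e \<alpha> p (basic_plane e p i j) \<longleftrightarrow> J_lin \<alpha> (axis i 1) $ j \<noteq> 0"
proof -
  have "inj (frame_vec e p)" by (simp add: inj_def frame_vec_inj)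
  then have "holomorphic_plane e \<alpha> p (basic_plane e p i j) \<longleftrightarrow>
      coord_plane i j = J_lin \<alpha> ` coord_plane i j"
    unfolding holomorphic_plane_def J_at_basic_plane unfolding basic_plane_eq
    by (rule inj_image_eq_iff)
  then show ?thesis by (simp add: coord_plane_J_invariant_iff[OF assms])
qed

text \<open>For basic planes, being totally real is the negation of being holomorphic: if \<open>J\<^sub>\<alpha>\<close> does not preserve the
  plane, it maps it onto the plane of the other two axes, which is orthogonal.\<close>

lemma totally_real_basic_plane_iff:
  assumes "i \<noteq> j"
  shows "totally_real_plane e \<alpha> p (basic_plane e p i j) \<longleftrightarrow> J_lin \<alpha> (axis i 1) $ j = 0"
proof
  assume "totally_real_plane e \<alpha> p (basic_plane e p i j)"
  then have "\<not> holomorphic_plane e \<alpha> p (basic_plane e p i j)"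
    unfolding totally_real_plane_def holomorphic_plane_def by metis
  then show "J_lin \<alpha> (axis i 1) $ j = 0"
    by (simp add: holomorphic_basic_plane_iff[OF assms])
next
  assume J: "J_lin \<alpha> (axis i 1) $ j = 0"
  then have "\<not> holomorphic_plane e \<alpha> p (basic_plane e p i j)"
    by (simp add: holomorphic_basic_plane_iff[OF assms])
  moreover have "\<forall>s\<in>basic_plane e p i j. \<forall>t\<in>J_at e \<alpha> p ` basic_plane e p i j.
      neutral_metric_at e p s t = 0"
    unfolding J_at_basic_plane unfolding basic_plane_eq
    by (auto simp: neutral_metric_at_frame_vec coord_plane_J_orthogonal[OF assms J])
  ultimately show "totally_real_plane e \<alpha> p (basic_plane e p i j)"
    unfolding totally_real_plane_def holomorphic_plane_def by metis
qed

end

context g45_frame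
begin

lemma nabla_J_frame_field:
  assumes x: "\<And>i. smooth_fun A (\<lambda>p. x p $ i)" and y: "\<And>i. smooth_fun A (\<lambda>p. y p $ i)"
  shows "nabla_J e D \<alpha> (frame_field e x) (frame_field e y) =
    frame_field e (\<lambda>p. nabla_J_lin a b \<alpha> (x p) (y p))"
proof -
  have Jy: "smooth_fun A (\<lambda>p. J_lin \<alpha> (y p) $ i)" for i
    unfolding J_lin_nth_sum by (rule smooth_fun_sum_mult[OF atlas y])
  have "frame_field e x (\<lambda>q. J_lin \<alpha> (y q) $ k) p
      = J_lin \<alpha> (\<chi> k. frame_field e x (\<lambda>q. y q $ k) p) $ k" for k p
    unfolding J_lin_nth_sum vec_lambda_beta
    by (rule vector_field_sum_mult[OF atlas frame_field_in[OF x] y])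
  then have "(\<chi> k. frame_field e x (\<lambda>q. J_lin \<alpha> (y q) $ k) p)
      = J_lin \<alpha> (\<chi> k. frame_field e x (\<lambda>q. y q $ k) p)" for p
    by (simp add: vec_eq_iff)
  then show ?thesis
    by (simp add: nabla_J_def J_field_frame_field D_frame_field[OF x y] D_frame_field[OF x Jy]
        nabla_J_lin_def linear_add[OF linear_J_lin] flip: frame_field_diff)
qed

lemma nijenhuis_frame_field:
  assumes x: "\<And>i. smooth_fun A (\<lambda>p. x p $ i)" and y: "\<And>i. smooth_fun A (\<lambda>p. y p $ i)"
  shows "nijenhuis e D \<alpha> (frame_field e x) (frame_field e y) =
    frame_field e (\<lambda>p. nijenhuis_lin a b \<alpha> (x p) (y p))"
proof -
  have J: "smooth_fun A (\<lambda>p. J_lin \<alpha> (z p) $ i)" if "\<And>i. smooth_fun A (\<lambda>p. z p $ i)" for z i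
    unfolding J_lin_nth_sum by (rule smooth_fun_sum_mult[OF atlas that])
  show ?thesis
    by (simp add: nijenhuis_def J_field_frame_field nabla_J_frame_field x y J nijenhuis_lin_def
        frame_field_add frame_field_diff)
qed

lemma nijenhuis_vanishes_iff:
  "(\<forall>\<alpha>. \<forall>X\<in>vector_fields A. \<forall>Y\<in>vector_fields A. nijenhuis e D \<alpha> X Y = 0) \<longleftrightarrow> a = 1 \<and> b = 1"
proof -
  have zero: "frame_field e (\<lambda>_. 0) = 0"
    by (simp add: frame_field_def frame_vec_zero fun_eq_iff)
  have "nijenhuis_lin a b \<alpha> x y = 0"
    if "\<forall>\<alpha>. \<forall>X\<in>vector_fields A. \<forall>Y\<in>vector_fields A. nijenhuis e D \<alpha> X Y = 0" for \<alpha> x y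
  proof -
    have "nijenhuis e D \<alpha> (frame_field e (\<lambda>_. x)) (frame_field e (\<lambda>_. y)) = 0"
      using that const_frame_field_in by blast
    then have "frame_field e (\<lambda>_. nijenhuis_lin a b \<alpha> x y) = frame_field e (\<lambda>_. 0)"
      by (simp add: nijenhuis_frame_field smooth_fun_const[OF atlas] zero)
    from fun_cong[OF frame_field_inj[OF this]] show ?thesis .
  qed
  moreover have "nijenhuis e D \<alpha> X Y = 0"
    if N: "\<forall>\<alpha> x y. nijenhuis_lin a b \<alpha> x y = 0"
      and X: "X \<in> vector_fields A" and Y: "Y \<in> vector_fields A" for \<alpha> X Y
  proof -
    obtain x where x: "\<forall>i. smooth_fun A (\<lambda>p. x p $ i)" "X = frame_field e x"
      using vector_field_components[OF X] .
    obtain y where y: "\<forall>i. smooth_fun A (\<lambda>p. y p $ i)" "Y = frame_field e y"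
      using vector_field_components[OF Y] .
    show ?thesis
      unfolding x(2) y(2) by (simp add: nijenhuis_frame_field x(1) y(1) N zero)
  qed
  ultimately show ?thesis using nijenhuis_lin_vanishes_iff[of a b] by blast
qed

lemma curv_const:
  "curv D (frame_field e (\<lambda>_. x)) (frame_field e (\<lambda>_. y)) (frame_field e (\<lambda>_. z)) =
    frame_field e (\<lambda>_. curv_lin a b x y z)"
  unfolding curv_def D_torsion[OF const_frame_field_in const_frame_field_in, symmetric]
  by (simp add: D_const curv_lin_def flip: frame_field_diff)

lemma curv4_const:
  "curv4 e D (frame_field e (\<lambda>_. x)) (frame_field e (\<lambda>_. y)) (frame_field e (\<lambda>_. z))
    (frame_field e (\<lambda>_. w)) p = neutral_form (curv_lin a b x y z) w"
  by (simp add: curv4_def curv_const neutral_metric_frame_field)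

lemma neutral_metric_frame: "neutral_metric e (e i) (e j) p = neutral_form (axis i 1) (axis j 1)"
  using neutral_metric_frame_field[of "\<lambda>_. axis i 1" "\<lambda>_. axis j 1"] by (simp add: frame_field_axis)

text \<open>The Gram matrix of the frame is diagonal with entries \<open>\<plusminus>1\<close>, hence its own inverse.\<close>

lemma metric_inv_eq: "metric_inv e i j p = neutral_form (axis i 1) (axis j 1)"
proof -
  define G :: "real^4^4" where "G = (\<chi> k l. neutral_form (axis k 1) (axis l 1))"
  have GG: "G ** G = mat 1"
    unfolding G_def
    by (simp add: vec_eq_iff forall_4 matrix_matrix_mult_def mat_def sum_4 neutral_form_def axis4_nth)
  have "G ** matrix_inv G = mat 1"
    unfolding matrix_inv_def using someI[of "\<lambda>B. G ** B = mat 1 \<and> B ** G = mat 1" G] GG by simp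
  then have "matrix_inv G = G"
    by (metis GG matrix_mul_assoc matrix_mul_lid matrix_mul_rid)
  then show ?thesis by (simp add: metric_inv_def neutral_metric_frame) (simp add: G_def)
qed

lemma curv4_frame:
  "curv4 e D (e i) (e j) (e k) (e l) p =
     neutral_form (curv_lin a b (axis i 1) (axis j 1) (axis k 1)) (axis l 1)"
  "curv4 e D (e i) (e j) (e k) (J_field e \<alpha> (e l)) p =
     neutral_form (curv_lin a b (axis i 1) (axis j 1) (axis k 1)) (J_lin \<alpha> (axis l 1))"
  "curv4 e D (e i) (e j) (J_field e \<alpha> (e k)) (J_field e \<alpha> (e l)) p =
     neutral_form (curv_lin a b (axis i 1) (axis j 1) (J_lin \<alpha> (axis k 1))) (J_lin \<alpha> (axis l 1))"
  by (simp_all add: curv4_const J_field_frame_field flip: frame_field_axis[of e])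

lemma contract:
  "(\<Sum>i\<in>UNIV. \<Sum>j\<in>UNIV. metric_inv e i j p * F i j) = F 1 1 + F 2 2 - F 3 3 - F 4 4"
  by (simp add: metric_inv_eq sum_4 neutral_form_def axis4_nth)

text \<open>Twice the sum of the six basic sectional curvatures \<open>1, a\<^sup>2, b\<^sup>2, a, b, a b\<close>, written as a sum of
  squares.\<close>

lemma scal_eq: "scal e D p = (1 + a + b)\<^sup>2 + 1 + a\<^sup>2 + b\<^sup>2"
  unfolding scal_def ricci_def contract curv4_frame curv_lin_simps
  by (simp add: curv_lin_simps power2_eq_square algebra_simps)

text \<open>\<open>R(e\<^sub>k, e\<^sub>i) e\<^sub>i\<close> is a multiple of \<open>e\<^sub>k\<close>, and \<open>J\<^sub>\<alpha> e\<^sub>k\<close> is orthogonal to \<open>e\<^sub>k\<close>.\<close>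

lemma scal_star_eq: "scal_star e D \<alpha> p = 0"
  unfolding scal_star_def ricci_star_def contract curv4_frame
  using exhaust_3[of \<alpha>] by (elim disjE) (simp_all add: curv_lin_simps J_lin_nth)

text \<open>Only the two basic planes that are holomorphic with respect to \<open>J\<^sub>\<alpha>\<close> contribute, and each contributes
  twice its sectional curvature.\<close>

lemma scal_star_star_eq:
  "scal_star_star e D 1 p = 2 * (a + b\<^sup>2)"
  "scal_star_star e D 2 p = 2 * (b + a\<^sup>2)"
  "scal_star_star e D 3 p = 2 * (a * b + 1)"
  unfolding scal_star_star_def ricci_star_def contract curv4_frame
  by (simp_all add: curv_lin_simps J_lin_nth power2_eq_square algebra_simps)

definition basic_curv :: "4 \<Rightarrow> 4 \<Rightarrow> real" where
  "basic_curv i j = neutral_form (curv_lin a b (axis i 1) (axis j 1) (axis j 1)) (axis i 1) /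
     (neutral_form (axis i 1) (axis i 1) * neutral_form (axis j 1) (axis j 1)
       - (neutral_form (axis i 1) (axis j 1))\<^sup>2)"

text \<open>With \<open>\<lambda> = (1, a, b)\<close>, that is \<open>[e\<^sub>i, e\<^sub>4] = \<lambda>\<^sub>i e\<^sub>i\<close>, these are \<open>k\<^sub>i\<^sub>j = \<lambda>\<^sub>i \<lambda>\<^sub>j\<close> and \<open>k\<^sub>i\<^sub>4 = \<lambda>\<^sub>i\<^sup>2\<close> for \<open>i, j < 4\<close>. The
  positivity statements compare the signs of these entries.\<close>

lemma basic_curv_simps:
  "basic_curv 1 2 = a" "basic_curv 1 3 = b" "basic_curv 1 4 = 1"
  "basic_curv 2 1 = a" "basic_curv 2 3 = a * b" "basic_curv 2 4 = a\<^sup>2"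
  "basic_curv 3 1 = b" "basic_curv 3 2 = a * b" "basic_curv 3 4 = b\<^sup>2"
  "basic_curv 4 1 = 1" "basic_curv 4 2 = a\<^sup>2" "basic_curv 4 3 = b\<^sup>2"
  by (simp_all add: basic_curv_def curv_lin_simps power2_eq_square)

lemma sect_curv_frame: "sect_curv e D (e i) (e j) p = basic_curv i j"
  by (simp add: sect_curv_def basic_curv_def curv4_frame neutral_metric_frame)

lemma holomorphic_curvatures_positive_iff:
  "holomorphic_curvatures_positive e D \<alpha> \<longleftrightarrow>
    (\<forall>i j. i \<noteq> j \<longrightarrow> J_lin \<alpha> (axis i 1) $ j \<noteq> 0 \<longrightarrow> basic_curv i j > 0)"
  unfolding holomorphic_curvatures_positive_def sect_curv_frame
  by (metis holomorphic_basic_plane_iff)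

lemma totally_real_curvatures_positive_iff:
  "totally_real_curvatures_positive e D \<alpha> \<longleftrightarrow>
    (\<forall>i j. i \<noteq> j \<longrightarrow> J_lin \<alpha> (axis i 1) $ j = 0 \<longrightarrow> basic_curv i j > 0)"
  unfolding totally_real_curvatures_positive_def sect_curv_frame
  by (metis totally_real_basic_plane_iff)

lemma curv_nonzero:
  "\<exists>X\<in>vector_fields A. \<exists>Y\<in>vector_fields A. \<exists>Z\<in>vector_fields A. curv D X Y Z \<noteq> 0"
proof (intro bexI)
  let ?f = "\<lambda>i. frame_field e (\<lambda>_. axis i 1)"
  show "curv D (?f 1) (?f 4) (?f 4) \<noteq> 0"
  proof
    assume "curv D (?f 1) (?f 4) (?f 4) = 0"
    then have "frame_field e (\<lambda>_. curv_lin a b (axis 1 1) (axis 4 1) (axis 4 1)) = frame_field e (\<lambda>_. 0)"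
      by (simp add: curv_const) (simp add: frame_field_def frame_vec_zero fun_eq_iff)
    from fun_cong[OF frame_field_inj[OF this]]
    have "curv_lin a b (axis 1 1) (axis 4 1) (axis 4 1) $ 1 = 0" by simp
    then show False by (simp add: curv_lin_simps)
  qed
qed (rule const_frame_field_in)+

end


section \<open>The classification\<close>

theorem theorem3p2:
  fixes L :: "('m::{t2_space, second_countable_topology}) monoid"
    and A :: "('m, real^4) atlas"
    and e :: "4 \<Rightarrow> 'm vfield"
    and D :: "'m vfield \<Rightarrow> 'm vfield \<Rightarrow> 'm vfield"
    and a b :: real
  assumes "a \<noteq> 0" and "b \<noteq> 0"
    and "lie_group L A"
    and "simply_connected (UNIV :: 'm set)"
    and "g45_basis L A a b e"
    and "levi_civita A (neutral_metric e) D"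
  shows
    "((\<forall>\<alpha>. \<forall>X\<in>vector_fields A. \<forall>Y\<in>vector_fields A. nijenhuis e D \<alpha> X Y = 0) \<longleftrightarrow> a = 1 \<and> b = 1) \<and>
     (\<exists>X\<in>vector_fields A. \<exists>Y\<in>vector_fields A. \<exists>Z\<in>vector_fields A. curv D X Y Z \<noteq> 0) \<and>
     (\<forall>p. scal e D p > 0) \<and>
     (\<forall>\<alpha> p. scal_star e D \<alpha> p = 0) \<and>
     ((\<forall>p. scal_star_star e D 1 p = 0) \<longleftrightarrow> a = - (b\<^sup>2)) \<and>
     ((\<forall>p. scal_star_star e D 2 p = 0) \<longleftrightarrow> b = - (a\<^sup>2)) \<and>
     ((\<forall>p. scal_star_star e D 3 p = 0) \<longleftrightarrow> a * b = - 1) \<and>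
     (holomorphic_curvatures_positive e D 1 \<longleftrightarrow> a > 0) \<and>
     (holomorphic_curvatures_positive e D 2 \<longleftrightarrow> b > 0) \<and>
     (holomorphic_curvatures_positive e D 3 \<longleftrightarrow> a * b > 0) \<and>
     ((\<forall>\<alpha>. totally_real_curvatures_positive e D \<alpha>) \<longleftrightarrow> a > 0 \<and> b > 0)"
proof -
  have basis: "lie_algebra_basis L A e" using assms(5) by (simp add: g45_basis_def)
  interpret smooth_frame A e
    by (rule lie_algebra_basis_imp_smooth_frame[OF assms(3) basis])
  interpret g45_frame A e a b D
    using assms(5,6) by unfold_locales (simp_all add: g45_basis_def)
  have hol: "holomorphic_curvatures_positive e D 1 \<longleftrightarrow> a > 0"
    "holomorphic_curvatures_positive e D 2 \<longleftrightarrow> b > 0"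
    "holomorphic_curvatures_positive e D 3 \<longleftrightarrow> a * b > 0"
    using assms(1,2)
    by (simp_all add: holomorphic_curvatures_positive_iff forall_4 J_lin_nth axis4_nth
        basic_curv_simps)
  have real: "(\<forall>\<alpha>. totally_real_curvatures_positive e D \<alpha>) \<longleftrightarrow> a > 0 \<and> b > 0"
    using assms(1,2)
    by (auto simp: totally_real_curvatures_positive_iff forall_3 forall_4 J_lin_nth axis4_nth
        basic_curv_simps)
  have "scal e D p > 0" for p
    unfolding scal_eq by (simp add: add_pos_nonneg add_nonneg_pos)
  moreover have "2 * (a + b\<^sup>2) = 0 \<longleftrightarrow> a = - (b\<^sup>2)" "2 * (b + a\<^sup>2) = 0 \<longleftrightarrow> b = - (a\<^sup>2)"
    "2 * (a * b + 1) = 0 \<longleftrightarrow> a * b = - 1"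
    by (simp_all add: add_eq_0_iff2 del: distrib_left_numeral)
  ultimately show ?thesis
    using nijenhuis_vanishes_iff curv_nonzero hol real
    by (simp only: scal_star_eq scal_star_star_eq simp_thms)
qed

end
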